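(* Let $\mathcal{C}$ be a fully triangulated category. Every distinguished map of $2$-triangles is good in the sense of Neeman: if $(f,g,h)$ is a distinguished map from $a\xrightarrow{u}b\xrightarrow{v}c\xrightarrow{w}a[1]$ to $a'\xrightarrow{u'}b'\xrightarrow{v'}c'\xrightarrow{w'}a'[1]$, then its mapping cone $$a'\oplus b\xrightarrow{\begin{pmatrix}u'&g\\0&-v\end{pmatrix}}b'\oplus c\xrightarrow{\begin{pmatrix}v'&h\\0&-w\end{pmatrix}}c'\oplus a[1]\xrightarrow{\begin{pmatrix}w'&f[1]\\0&-u[1]\end{pmatrix}}(a'\oplus b)[1]$$ is a distinguished $2$-triangle.
   Context: Setting. $\mathcal{C}$ is an additive category with an additive automorphism $[1]$. For $n\ge 1$, an $n$-triangle (or $R_n$-diagram) $A$ in $\mathcal{C}$ consists of objects $a_{i,j}$ ($0\le i<j\le n$) and, for all $0\le i<j<k\le n$, morphisms (edges) (i) $a_{i,j}\to a_{i,k}$, (ii) $a_{i,k}\to a_{j,k}$, (iii) $a_{j,k}\to a_{i,j}[1]$ ("degree-one edges"), such that: (S) for each index $m$, the edges among $a_{m,m+1},\dots,a_{m,n},a_{0,m}[1],\dots,a_{m-1,m}[1]$ (shifted where needed) form a commuting diagram, so that each edge is the composite of consecutive ones; (Q) for $i<j<k<l$ the squares $a_{i,k}\to a_{i,l}\to a_{j,l}$ $=$ $a_{i,k}\to a_{j,k}\to a_{j,l}$ and $a_{j,l}\to a_{k,l}\to a_{i,k}[1]$ $=$ $a_{j,l}\to a_{i,j}[1]\to a_{i,k}[1]$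 commute. A morphism of $n$-triangles is a family of morphisms between corresponding objects commuting with all edges (with $[1]$ applied where appropriate); this gives a category $\Pi_n$. A $2$-triangle is a diagram $a\xrightarrow{u}b\xrightarrow{v}c\xrightarrow{w}a[1]$ ($a=a_{0,1}$, $b=a_{0,2}$, $c=a_{1,2}$), written $(u,v,w)$, and a morphism $(f,g,h):(u,v,w)\to(u',v',w')$ satisfies $gu=u'f$, $hv=v'g$, $f[1]w=w'h$. Faces and degeneracies. For $0\le m\le n$ the face functor $F_m:\Pi_n\to\Pi_{n-1}$ discards all objects having $m$ as an index (and relabels the remaining indices in order). The degeneracy functor $\Pi_{n-1}\to\Pi_n$ repeats index $m$: with $s:\{0,\dots,n\}\to\{0,\dots,n-1\}$ the monotone surjection hitting $m$ twice, the new object at $(i,j)$ is $a_{s(i),s(j)}$ if $s(i)\ne s(j)$ and $0$ otherwise, with the evident edges (original edges, identities or zeros). Base. An $(n-1)$-simplex diagram is a commuting diagram on a chain $x_1\to x_2\to\cdots\to x_n$; the base of $A$ is $a_{0,1}\to a_{0,2}\to\cdots\to a_{0,n}$. Rotations. $\tau(A)$ has objects $\tau(A)_{0,j}=a_{j-1,n}$ and $\tau(A)_{i,j}=a_{i-1,j-1}[1]$ for $1\le i<j$, with the corresponding (shifted) edges of $A$ but with all degree-one edges of $\tau(A)$ multiplied by $-1$ (for $n=2$: $b\xrightarrow{v}c\xrightarrow{w}a[1]\xrightarrow{-u[1]}b[1]$). $\sigma(A)$ has objects $a_{i,j}[1]$, shifted edges, with degree-one edges multiplied by $-1$. $\mathcal{C}$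 is fully triangulated if for each $n\ge2$ there is given a subcategory $D_n\subset\Pi_n$, whose objects are called distinguished $n$-triangles and whose morphisms are called distinguished morphisms (maps), such that for all $n\geq 2$: (1) Isomorphism: any isomorphism between objects of $D_n$ is distinguished, and any object of $\Pi_n$ isomorphic to a distinguished $n$-triangle is distinguished. (2) Rotation: if $A\in D_n$ then $\tau(A),\sigma(A)\in D_n$. (3) Faces: for $n>2$, face functors send distinguished maps of $n$-triangles to distinguished maps of $(n-1)$-triangles, and degeneracy functors send distinguished maps of $(n-1)$-triangles to distinguished maps of $n$-triangles. (4) Bases: every $(n-1)$-simplex diagram is the base of some distinguished $n$-triangle, and every map of $(n-1)$-simplex diagrams $\Sigma\to\Sigma'$ extends to a distinguished map between any given distinguished $n$-triangles with bases $\Sigma,\Sigma'$. (5) Lightning strike: if $(f,g,h)$ and $(f,g,h')$ are distinguished maps between the same two distinguished $2$-triangles $(u,v,w)$ and $(u',v',w')$, then $h'-h=v'\theta w$ for some $\theta:a[1]\to b'$. *)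

theory Defs
  imports "HOL-Algebra.Group"
begin

section \<open>Additive categories with an additive automorphism\<close>

record ('o, 'm) shift_cat =
  Obj :: "'o set"
  Arr :: "'m set"
  src :: "'m \<Rightarrow> 'o"
  tgt :: "'m \<Rightarrow> 'o"
  ident :: "'o \<Rightarrow> 'm"
  cmp :: "'m \<Rightarrow> 'm \<Rightarrow> 'm" (infixl "\<cdot>\<index>" 70)  \<comment> \<open>\<open>g \<cdot> f\<close> is ``first f, then g''\<close>
  madd :: "'m \<Rightarrow> 'm \<Rightarrow> 'm" (infixl "\<boxplus>\<index>" 65)
  mzero :: "'o \<Rightarrow> 'o \<Rightarrow> 'm"
  zero_ob :: "'o"
  sho :: "'o \<Rightarrow> 'o"  \<comment> \<open>\<open>a \<mapsto> a[1]\<close>\<close>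
  sha :: "'m \<Rightarrow> 'm"  \<comment> \<open>\<open>f \<mapsto> f[1]\<close>\<close>

definition Hom :: "('o, 'm) shift_cat \<Rightarrow> 'o \<Rightarrow> 'o \<Rightarrow> 'm set" where
  "Hom C a b = {f \<in> Arr C. src C f = a \<and> tgt C f = b}"

definition hom_group :: "('o, 'm) shift_cat \<Rightarrow> 'o \<Rightarrow> 'o \<Rightarrow> 'm monoid" where
  "hom_group C a b = \<lparr>carrier = Hom C a b, monoid.mult = madd C, one = mzero C a b\<rparr>"

definition mneg :: "('o, 'm) shift_cat \<Rightarrow> 'm \<Rightarrow> 'm" where
  "mneg C f = inv\<^bsub>hom_group C (src C f) (tgt C f)\<^esub> f"

definition mdiff :: "('o, 'm) shift_cat \<Rightarrow> 'm \<Rightarrow> 'm \<Rightarrow> 'm" where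
  "mdiff C f g = madd C f (mneg C g)"

definition zero_object :: "('o, 'm) shift_cat \<Rightarrow> 'o \<Rightarrow> bool" where
  "zero_object C z \<longleftrightarrow> z \<in> Obj C \<and>
     (\<forall>a \<in> Obj C. (\<exists>!f. f \<in> Hom C a z) \<and> (\<exists>!f. f \<in> Hom C z a))"

record ('o, 'm) biprod =
  sum_ob :: 'o
  in1 :: 'm
  in2 :: 'm
  pr1 :: 'm
  pr2 :: 'm

definition is_biproduct :: "('o, 'm) shift_cat \<Rightarrow> 'o \<Rightarrow> 'o \<Rightarrow> ('o, 'm) biprod \<Rightarrow> bool" where
  "is_biproduct C a b P \<longleftrightarrow>
     a \<in> Obj C \<and> b \<in> Obj C \<and> sum_ob P \<in> Obj C \<and>
     in1 P \<in> Hom C a (sum_ob P) \<and> in2 P \<in> Hom C b (sum_ob P) \<and>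
     pr1 P \<in> Hom C (sum_ob P) a \<and> pr2 P \<in> Hom C (sum_ob P) b \<and>
     cmp C (pr1 P) (in1 P) = ident C a \<and> cmp C (pr2 P) (in2 P) = ident C b \<and>
     cmp C (pr1 P) (in2 P) = mzero C b a \<and> cmp C (pr2 P) (in1 P) = mzero C a b \<and>
     madd C (cmp C (in1 P) (pr1 P)) (cmp C (in2 P) (pr2 P)) = ident C (sum_ob P)"

locale shifted_additive_category =
  fixes C :: "('o, 'm) shift_cat" (structure)
  assumes src_ob: "f \<in> Arr C \<Longrightarrow> src C f \<in> Obj C"
    and tgt_ob: "f \<in> Arr C \<Longrightarrow> tgt C f \<in> Obj C"
    and ident_hom: "a \<in> Obj C \<Longrightarrow> ident C a \<in> Hom C a a"
    and cmp_hom: "\<lbrakk>f \<in> Hom C a b; g \<in> Hom C b c\<rbrakk> \<Longrightarrow> g \<cdot> f \<in> Hom C a c"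
    and cmp_ident_right: "f \<in> Hom C a b \<Longrightarrow> f \<cdot> ident C a = f"
    and cmp_ident_left: "f \<in> Hom C a b \<Longrightarrow> ident C b \<cdot> f = f"
    and cmp_assoc: "\<lbrakk>f \<in> Hom C a b; g \<in> Hom C b c; h \<in> Hom C c d\<rbrakk>
                      \<Longrightarrow> (h \<cdot> g) \<cdot> f = h \<cdot> (g \<cdot> f)"
    and hom_comm_group: "\<lbrakk>a \<in> Obj C; b \<in> Obj C\<rbrakk> \<Longrightarrow> comm_group (hom_group C a b)"
    and cmp_madd_right: "\<lbrakk>f \<in> Hom C a b; f' \<in> Hom C a b; g \<in> Hom C b c\<rbrakk>
                      \<Longrightarrow> g \<cdot> (f \<boxplus> f') = (g \<cdot> f) \<boxplus> (g \<cdot> f')"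
    and cmp_madd_left: "\<lbrakk>f \<in> Hom C a b; g \<in> Hom C b c; g' \<in> Hom C b c\<rbrakk>
                      \<Longrightarrow> (g \<boxplus> g') \<cdot> f = (g \<cdot> f) \<boxplus> (g' \<cdot> f)"
    and zero_ob: "zero_object C (zero_ob C)"
    and biproducts: "\<lbrakk>a \<in> Obj C; b \<in> Obj C\<rbrakk> \<Longrightarrow> \<exists>P. is_biproduct C a b P"
    and sho_bij: "bij_betw (sho C) (Obj C) (Obj C)"
    and sha_bij: "bij_betw (sha C) (Arr C) (Arr C)"
    and sha_hom: "f \<in> Hom C a b \<Longrightarrow> sha C f \<in> Hom C (sho C a) (sho C b)"
    and sha_ident: "a \<in> Obj C \<Longrightarrow> sha C (ident C a) = ident C (sho C a)"
    and sha_cmp: "\<lbrakk>f \<in> Hom C a b; g \<in> Hom C b c\<rbrakk> \<Longrightarrow> sha C (g \<cdot> f) = sha C g \<cdot> sha C f"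
    and sha_madd: "\<lbrakk>f \<in> Hom C a b; g \<in> Hom C a b\<rbrakk> \<Longrightarrow> sha C (f \<boxplus> g) = sha C f \<boxplus> sha C g"


section \<open>The category of n-triangles\<close>

text \<open>
  For \<open>i < j < k\<close>, the edges of an n-triangle with objects \<open>a i j = vert A i j\<close> are
  \<open>edge1 A i j k : a i j \<rightarrow> a i k\<close>, \<open>edge2 A i j k : a i k \<rightarrow> a j k\<close> and
  \<open>edge3 A i j k : a j k \<rightarrow> (a i j)[1]\<close>. Outside the index range \<open>i < j (< k) \<le> n\<close> all
  these functions, and the families constituting morphisms, are required to be \<open>undefined\<close>,
  so that equality in HOL is equality of n-triangles and of their morphisms.
\<close>

record ('o, 'm) tri =
  vert :: "nat \<Rightarrow> nat \<Rightarrow> 'o"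
  edge1 :: "nat \<Rightarrow> nat \<Rightarrow> nat \<Rightarrow> 'm"
  edge2 :: "nat \<Rightarrow> nat \<Rightarrow> nat \<Rightarrow> 'm"
  edge3 :: "nat \<Rightarrow> nat \<Rightarrow> nat \<Rightarrow> 'm"

definition restr2 :: "nat \<Rightarrow> (nat \<Rightarrow> nat \<Rightarrow> 'x) \<Rightarrow> nat \<Rightarrow> nat \<Rightarrow> 'x" where
  "restr2 n f = (\<lambda>i j. if i < j \<and> j \<le> n then f i j else undefined)"

definition restr3 :: "nat \<Rightarrow> (nat \<Rightarrow> nat \<Rightarrow> nat \<Rightarrow> 'x) \<Rightarrow> nat \<Rightarrow> nat \<Rightarrow> nat \<Rightarrow> 'x" where
  "restr3 n f = (\<lambda>i j k. if i < j \<and> j < k \<and> k \<le> n then f i j k else undefined)"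

definition restr_tri :: "nat \<Rightarrow> ('o, 'm) tri \<Rightarrow> ('o, 'm) tri" where
  "restr_tri n A = \<lparr>vert = restr2 n (vert A), edge1 = restr3 n (edge1 A),
                    edge2 = restr3 n (edge2 A), edge3 = restr3 n (edge3 A)\<rparr>"

text \<open>
  The four equations \<open>star_*\<close> say that, for fixed \<open>m\<close>, the diagram on
  \<open>a m (m+1), \<dots>, a m n, (a 0 m)[1], \<dots>, (a (m-1) m)[1]\<close> commutes; they are sorted by
  how many of the three objects involved in a composition are shifted.
\<close>

definition is_tri :: "('o, 'm) shift_cat \<Rightarrow> nat \<Rightarrow> ('o, 'm) tri \<Rightarrow> bool" where
  "is_tri C n A \<longleftrightarrow>
     restr_tri n A = A \<and>
     (\<forall>i j. i < j \<and> j \<le> n \<longrightarrow> vert A i j \<in> Obj C) \<and>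
     (\<forall>i j k. i < j \<and> j < k \<and> k \<le> n \<longrightarrow>
        edge1 A i j k \<in> Hom C (vert A i j) (vert A i k) \<and>
        edge2 A i j k \<in> Hom C (vert A i k) (vert A j k) \<and>
        edge3 A i j k \<in> Hom C (vert A j k) (sho C (vert A i j))) \<and>
     \<comment> \<open>star_0\<close>
     (\<forall>m i j k. m < i \<and> i < j \<and> j < k \<and> k \<le> n \<longrightarrow>
        edge1 A m i k = cmp C (edge1 A m j k) (edge1 A m i j)) \<and>
     \<comment> \<open>star_1\<close>
     (\<forall>m i j k. i < m \<and> m < j \<and> j < k \<and> k \<le> n \<longrightarrow>
        edge3 A i m j = cmp C (edge3 A i m k) (edge1 A m j k)) \<and>
     \<comment> \<open>star_2\<close>
     (\<forall>m i j k. i < j \<and> j < m \<and> m < k \<and> k \<le> n \<longrightarrow>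
        edge3 A j m k = cmp C (sha C (edge2 A i j m)) (edge3 A i m k)) \<and>
     \<comment> \<open>star_3\<close>
     (\<forall>m i j k. i < j \<and> j < k \<and> k < m \<and> m \<le> n \<longrightarrow>
        sha C (edge2 A i k m) = cmp C (sha C (edge2 A j k m)) (sha C (edge2 A i j m))) \<and>
     \<comment> \<open>squares\<close>
     (\<forall>i j k l. i < j \<and> j < k \<and> k < l \<and> l \<le> n \<longrightarrow>
        cmp C (edge2 A i j l) (edge1 A i k l) = cmp C (edge1 A j k l) (edge2 A i j k) \<and>
        cmp C (edge3 A i k l) (edge2 A j k l) = cmp C (sha C (edge1 A i j k)) (edge3 A i j l))"

definition tri_maps ::
  "('o, 'm) shift_cat \<Rightarrow> nat \<Rightarrow> ('o, 'm) tri \<Rightarrow> ('o, 'm) tri \<Rightarrow> (nat \<Rightarrow> nat \<Rightarrow> 'm) set" where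
  "tri_maps C n A B = {\<phi>.
     is_tri C n A \<and> is_tri C n B \<and> restr2 n \<phi> = \<phi> \<and>
     (\<forall>i j. i < j \<and> j \<le> n \<longrightarrow> \<phi> i j \<in> Hom C (vert A i j) (vert B i j)) \<and>
     (\<forall>i j k. i < j \<and> j < k \<and> k \<le> n \<longrightarrow>
        cmp C (\<phi> i k) (edge1 A i j k) = cmp C (edge1 B i j k) (\<phi> i j) \<and>
        cmp C (\<phi> j k) (edge2 A i j k) = cmp C (edge2 B i j k) (\<phi> i k) \<and>
        cmp C (sha C (\<phi> i j)) (edge3 A i j k) = cmp C (edge3 B i j k) (\<phi> j k))}"

definition tri_ident :: "('o, 'm) shift_cat \<Rightarrow> nat \<Rightarrow> ('o, 'm) tri \<Rightarrow> nat \<Rightarrow> nat \<Rightarrow> 'm" where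
  "tri_ident C n A = restr2 n (\<lambda>i j. ident C (vert A i j))"

definition tri_cmp :: "('o, 'm) shift_cat \<Rightarrow> nat \<Rightarrow>
    (nat \<Rightarrow> nat \<Rightarrow> 'm) \<Rightarrow> (nat \<Rightarrow> nat \<Rightarrow> 'm) \<Rightarrow> nat \<Rightarrow> nat \<Rightarrow> 'm" where
  "tri_cmp C n \<psi> \<phi> = restr2 n (\<lambda>i j. cmp C (\<psi> i j) (\<phi> i j))"

definition tri_isos ::
  "('o, 'm) shift_cat \<Rightarrow> nat \<Rightarrow> ('o, 'm) tri \<Rightarrow> ('o, 'm) tri \<Rightarrow> (nat \<Rightarrow> nat \<Rightarrow> 'm) set" where
  "tri_isos C n A B = {\<phi> \<in> tri_maps C n A B. \<exists>\<psi> \<in> tri_maps C n B A.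
     tri_cmp C n \<psi> \<phi> = tri_ident C n A \<and> tri_cmp C n \<phi> \<psi> = tri_ident C n B}"

definition tri2 :: "'o \<Rightarrow> 'o \<Rightarrow> 'o \<Rightarrow> 'm \<Rightarrow> 'm \<Rightarrow> 'm \<Rightarrow> ('o, 'm) tri" where
  "tri2 a b c u v w = restr_tri 2
     \<lparr>vert = (\<lambda>i j. if i = 0 then (if j = 1 then a else b) else c),
      edge1 = (\<lambda>i j k. u), edge2 = (\<lambda>i j k. v), edge3 = (\<lambda>i j k. w)\<rparr>"

definition tri2_map :: "'m \<Rightarrow> 'm \<Rightarrow> 'm \<Rightarrow> nat \<Rightarrow> nat \<Rightarrow> 'm" where
  "tri2_map f g h = restr2 2 (\<lambda>i j. if i = 0 then (if j = 1 then f else g) else h)"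


section \<open>Faces, degeneracies, rotations, bases\<close>

definition skip :: "nat \<Rightarrow> nat \<Rightarrow> nat" where
  "skip m i = (if i < m then i else Suc i)"

definition dup :: "nat \<Rightarrow> nat \<Rightarrow> nat" where
  "dup m i = (if i \<le> m then i else i - 1)"

definition face :: "nat \<Rightarrow> nat \<Rightarrow> ('o, 'm) tri \<Rightarrow> ('o, 'm) tri" where
  "face n m A = restr_tri (n - 1)
     \<lparr>vert = (\<lambda>i j. vert A (skip m i) (skip m j)),
      edge1 = (\<lambda>i j k. edge1 A (skip m i) (skip m j) (skip m k)),
      edge2 = (\<lambda>i j k. edge2 A (skip m i) (skip m j) (skip m k)),
      edge3 = (\<lambda>i j k. edge3 A (skip m i) (skip m j) (skip m k))\<rparr>"

definition face_map :: "nat \<Rightarrow> nat \<Rightarrow> (nat \<Rightarrow> nat \<Rightarrow> 'm) \<Rightarrow> nat \<Rightarrow> nat \<Rightarrow> 'm" where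
  "face_map n m \<phi> = restr2 (n - 1) (\<lambda>i j. \<phi> (skip m i) (skip m j))"

text \<open>The degeneracies \<open>\<Pi>\<^bsub>n-1\<^esub> \<rightarrow> \<Pi>\<^bsub>n\<^esub>\<close>; here \<open>n\<close> is the size of the result.
  The result satisfies the square equations only if the composites \<open>a i j \<rightarrow> a i k \<rightarrow> a j k\<close>
  and so on vanish in \<open>A\<close>; for distinguished \<open>A\<close> this is part of what the
  degeneracy axiom asserts.\<close>

definition degen_vert :: "('o, 'm) shift_cat \<Rightarrow> nat \<Rightarrow> ('o, 'm) tri \<Rightarrow> nat \<Rightarrow> nat \<Rightarrow> 'o" where
  "degen_vert C m A i j =
     (if dup m i = dup m j then zero_ob C else vert A (dup m i) (dup m j))"

definition degen :: "('o, 'm) shift_cat \<Rightarrow> nat \<Rightarrow> nat \<Rightarrow> ('o, 'm) tri \<Rightarrow> ('o, 'm) tri" where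
  "degen C n m A = restr_tri n
     \<lparr>vert = degen_vert C m A,
      edge1 = (\<lambda>i j k.
        if dup m i = dup m j then mzero C (degen_vert C m A i j) (degen_vert C m A i k)
        else if dup m j = dup m k then ident C (degen_vert C m A i j)
        else edge1 A (dup m i) (dup m j) (dup m k)),
      edge2 = (\<lambda>i j k.
        if dup m i = dup m j then ident C (degen_vert C m A i k)
        else if dup m j = dup m k then mzero C (degen_vert C m A i k) (degen_vert C m A j k)
        else edge2 A (dup m i) (dup m j) (dup m k)),
      edge3 = (\<lambda>i j k.
        if dup m i = dup m j \<or> dup m j = dup m k
        then mzero C (degen_vert C m A j k) (sho C (degen_vert C m A i j))
        else edge3 A (dup m i) (dup m j) (dup m k))\<rparr>"

definition degen_map :: "('o, 'm) shift_cat \<Rightarrow> nat \<Rightarrow> nat \<Rightarrow>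
    (nat \<Rightarrow> nat \<Rightarrow> 'm) \<Rightarrow> nat \<Rightarrow> nat \<Rightarrow> 'm" where
  "degen_map C n m \<phi> = restr2 n (\<lambda>i j.
     if dup m i = dup m j then ident C (zero_ob C) else \<phi> (dup m i) (dup m j))"

definition rot :: "('o, 'm) shift_cat \<Rightarrow> nat \<Rightarrow> ('o, 'm) tri \<Rightarrow> ('o, 'm) tri" where
  "rot C n A = restr_tri n
     \<lparr>vert = (\<lambda>i j. if i = 0 then vert A (j-1) n else sho C (vert A (i-1) (j-1))),
      edge1 = (\<lambda>i j k. if i = 0 then edge2 A (j-1) (k-1) n
                        else sha C (edge1 A (i-1) (j-1) (k-1))),
      edge2 = (\<lambda>i j k. if i = 0 then edge3 A (j-1) (k-1) n
                        else sha C (edge2 A (i-1) (j-1) (k-1))),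
      edge3 = (\<lambda>i j k. if i = 0 then mneg C (sha C (edge1 A (j-1) (k-1) n))
                        else mneg C (sha C (edge3 A (i-1) (j-1) (k-1))))\<rparr>"

definition shift_tri :: "('o, 'm) shift_cat \<Rightarrow> nat \<Rightarrow> ('o, 'm) tri \<Rightarrow> ('o, 'm) tri" where
  "shift_tri C n A = restr_tri n
     \<lparr>vert = (\<lambda>i j. sho C (vert A i j)),
      edge1 = (\<lambda>i j k. sha C (edge1 A i j k)),
      edge2 = (\<lambda>i j k. sha C (edge2 A i j k)),
      edge3 = (\<lambda>i j k. mneg C (sha C (edge3 A i j k)))\<rparr>"

text \<open>
  An (n-1)-simplex diagram on \<open>x 1 \<rightarrow> \<dots> \<rightarrow> x n\<close>, given with all its composites
  \<open>sedge S i j : x i \<rightarrow> x j\<close>; as before, \<open>undefined\<close> outside the index range.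
\<close>

record ('o, 'm) simplex =
  svert :: "nat \<Rightarrow> 'o"
  sedge :: "nat \<Rightarrow> nat \<Rightarrow> 'm"

definition restr_simplex :: "nat \<Rightarrow> ('o, 'm) simplex \<Rightarrow> ('o, 'm) simplex" where
  "restr_simplex n S =
     \<lparr>svert = (\<lambda>i. if 1 \<le> i \<and> i \<le> n then svert S i else undefined),
      sedge = (\<lambda>i j. if 1 \<le> i \<and> i < j \<and> j \<le> n then sedge S i j else undefined)\<rparr>"

definition is_simplex :: "('o, 'm) shift_cat \<Rightarrow> nat \<Rightarrow> ('o, 'm) simplex \<Rightarrow> bool" where
  "is_simplex C n S \<longleftrightarrow>
     restr_simplex n S = S \<and>
     (\<forall>i. 1 \<le> i \<and> i \<le> n \<longrightarrow> svert S i \<in> Obj C) \<and>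
     (\<forall>i j. 1 \<le> i \<and> i < j \<and> j \<le> n \<longrightarrow> sedge S i j \<in> Hom C (svert S i) (svert S j)) \<and>
     (\<forall>i j k. 1 \<le> i \<and> i < j \<and> j < k \<and> k \<le> n \<longrightarrow>
        sedge S i k = cmp C (sedge S j k) (sedge S i j))"

definition is_simplex_map :: "('o, 'm) shift_cat \<Rightarrow> nat \<Rightarrow>
    ('o, 'm) simplex \<Rightarrow> ('o, 'm) simplex \<Rightarrow> (nat \<Rightarrow> 'm) \<Rightarrow> bool" where
  "is_simplex_map C n S T f \<longleftrightarrow>
     is_simplex C n S \<and> is_simplex C n T \<and>
     (\<forall>i. 1 \<le> i \<and> i \<le> n \<longrightarrow> f i \<in> Hom C (svert S i) (svert T i)) \<and>
     (\<forall>i j. 1 \<le> i \<and> i < j \<and> j \<le> n \<longrightarrow>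
        cmp C (f j) (sedge S i j) = cmp C (sedge T i j) (f i))"

definition base :: "nat \<Rightarrow> ('o, 'm) tri \<Rightarrow> ('o, 'm) simplex" where
  "base n A = restr_simplex n \<lparr>svert = vert A 0, sedge = edge1 A 0\<rparr>"


section \<open>Fully triangulated categories\<close>

text \<open>
  \<open>D n\<close> is the set of distinguished n-triangles, \<open>M n A B\<close> the set of distinguished maps
  from \<open>A\<close> to \<open>B\<close>; their values for \<open>n < 2\<close> are irrelevant.
\<close>

locale fully_triangulated = shifted_additive_category C
  for C :: "('o, 'm) shift_cat" (structure) +
  fixes D :: "nat \<Rightarrow> ('o, 'm) tri set"
    and M :: "nat \<Rightarrow> ('o, 'm) tri \<Rightarrow> ('o, 'm) tri \<Rightarrow> (nat \<Rightarrow> nat \<Rightarrow> 'm) set"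
  assumes dist_tri: "\<lbrakk>n \<ge> 2; A \<in> D n\<rbrakk> \<Longrightarrow> is_tri C n A"
    and dist_map: "\<lbrakk>n \<ge> 2; \<phi> \<in> M n A B\<rbrakk> \<Longrightarrow> A \<in> D n \<and> B \<in> D n \<and> \<phi> \<in> tri_maps C n A B"
    and dist_ident: "\<lbrakk>n \<ge> 2; A \<in> D n\<rbrakk> \<Longrightarrow> tri_ident C n A \<in> M n A A"
    and dist_cmp: "\<lbrakk>n \<ge> 2; \<phi> \<in> M n A B; \<psi> \<in> M n B E\<rbrakk> \<Longrightarrow> tri_cmp C n \<psi> \<phi> \<in> M n A E"
    and iso_map: "\<lbrakk>n \<ge> 2; A \<in> D n; B \<in> D n; \<phi> \<in> tri_isos C n A B\<rbrakk> \<Longrightarrow> \<phi> \<in> M n A B"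
    and iso_tri: "\<lbrakk>n \<ge> 2; A \<in> D n; \<phi> \<in> tri_isos C n A B\<rbrakk> \<Longrightarrow> B \<in> D n"
    and rotation: "\<lbrakk>n \<ge> 2; A \<in> D n\<rbrakk> \<Longrightarrow> rot C n A \<in> D n"
    and shift: "\<lbrakk>n \<ge> 2; A \<in> D n\<rbrakk> \<Longrightarrow> shift_tri C n A \<in> D n"
    and faces: "\<lbrakk>n > 2; m \<le> n; \<phi> \<in> M n A B\<rbrakk>
                  \<Longrightarrow> face_map n m \<phi> \<in> M (n - 1) (face n m A) (face n m B)"
    and degeneracies: "\<lbrakk>n > 2; m \<le> n - 1; \<phi> \<in> M (n - 1) A B\<rbrakk>
                  \<Longrightarrow> degen_map C n m \<phi> \<in> M n (degen C n m A) (degen C n m B)"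
    and base_ex: "\<lbrakk>n \<ge> 2; is_simplex C n S\<rbrakk> \<Longrightarrow> \<exists>A \<in> D n. base n A = S"
    and base_map_ex: "\<lbrakk>n \<ge> 2; A \<in> D n; B \<in> D n; is_simplex_map C n (base n A) (base n B) t\<rbrakk>
                  \<Longrightarrow> \<exists>\<phi> \<in> M n A B. \<forall>j. 1 \<le> j \<and> j \<le> n \<longrightarrow> \<phi> 0 j = t j"
    and lightning: "\<lbrakk>tri2_map f g h \<in> M 2 (tri2 a b c u v w) (tri2 a' b' c' u' v' w');
                     tri2_map f g h' \<in> M 2 (tri2 a b c u v w) (tri2 a' b' c' u' v' w')\<rbrakk>
                  \<Longrightarrow> \<exists>\<theta> \<in> Hom C (sho C a) b'. mdiff C h' h = v' \<cdot> \<theta> \<cdot> w"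


section \<open>Mapping cones\<close>

text \<open>
  The morphism between direct sums \<open>P\<close> and \<open>Q\<close> given by the 2 x 2 matrix with rows
  \<open>(p, q)\<close> and \<open>(r, s)\<close>, acting on columns.
\<close>

definition mat2 :: "('o, 'm) shift_cat \<Rightarrow> ('o, 'm) biprod \<Rightarrow> ('o, 'm) biprod \<Rightarrow>
    'm \<Rightarrow> 'm \<Rightarrow> 'm \<Rightarrow> 'm \<Rightarrow> 'm" where
  "mat2 C P Q p q r s =
     madd C
       (madd C (cmp C (in1 Q) (cmp C p (pr1 P))) (cmp C (in1 Q) (cmp C q (pr2 P))))
       (madd C (cmp C (in2 Q) (cmp C r (pr1 P))) (cmp C (in2 Q) (cmp C s (pr2 P))))"

definition shift_biprod :: "('o, 'm) shift_cat \<Rightarrow> ('o, 'm) biprod \<Rightarrow> ('o, 'm) biprod" where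
  "shift_biprod C P = \<lparr>sum_ob = sho C (sum_ob P), in1 = sha C (in1 P), in2 = sha C (in2 P),
                       pr1 = sha C (pr1 P), pr2 = sha C (pr2 P)\<rparr>"

text \<open>
  The mapping cone of \<open>(f, g, h) : (u, v, w) \<rightarrow> (u', v', w')\<close>, formed with
  \<open>P = a' \<oplus> b\<close>, \<open>Q = b' \<oplus> c\<close> and \<open>R = c' \<oplus> a[1]\<close>.
\<close>

definition mapping_cone :: "('o, 'm) shift_cat \<Rightarrow>
    ('o, 'm) biprod \<Rightarrow> ('o, 'm) biprod \<Rightarrow> ('o, 'm) biprod \<Rightarrow>
    'o \<Rightarrow> 'o \<Rightarrow> 'o \<Rightarrow> 'm \<Rightarrow> 'm \<Rightarrow> 'm \<Rightarrow> 'o \<Rightarrow> 'o \<Rightarrow> 'o \<Rightarrow> 'm \<Rightarrow> 'm \<Rightarrow> 'm \<Rightarrow>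
    'm \<Rightarrow> 'm \<Rightarrow> 'm \<Rightarrow> ('o, 'm) tri" where
  "mapping_cone C P Q R a b c u v w a' b' c' u' v' w' f g h =
     tri2 (sum_ob P) (sum_ob Q) (sum_ob R)
       (mat2 C P Q u' g (mzero C a' c) (mneg C v))
       (mat2 C Q R v' h (mzero C b' (sho C a)) (mneg C w))
       (mat2 C R (shift_biprod C P) w' (sha C f) (mzero C c' (sho C b)) (mneg C (sha C u)))"

end

theory Submission
  imports Defs
begin

text \<open>
  Two facts carry the proof.

  \<^item> Every commuting square \<open>(f, g)\<close> between the first edges of two distinguished triangles extends
    to \<^emph>\<open>some\<close> map \<open>(f, g, h0)\<close> with a distinguished cone (\<open>cone_exists\<close>). The first map of the cone
    factors as \<open>a' \<oplus> b \<rightarrow> b' \<oplus> b \<rightarrow> b' \<oplus> c\<close>, where the first factor has entries \<open>u'\<close>, \<open>g\<close>, \<open>1\<close> and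
    the second has diagonal entries \<open>1\<close>, \<open>-v\<close>. Up to a shear both factors are sums of a known
    triangle with a contractible one, so their third vertices are \<open>c'\<close> and \<open>a[1]\<close>. The octahedron on
    this composite places its third vertex \<open>z\<close> in a triangle \<open>c' \<rightarrow> z \<rightarrow> a[1] \<rightarrow> c'[1]\<close> with
    connecting map \<open>(v' g u)[1] = (v' u' f)[1] = 0\<close>. Hence \<open>z\<close> splits as \<open>c' \<oplus> a[1]\<close>, the splitting
    can be chosen so that the third map of the cone has the required entries, and \<open>h0\<close> is the
    one entry of the second map that is not forced.

  \<^item> Two maps with the same \<open>f\<close> and \<open>g\<close> have third components that differ by
    \<open>v' \<theta> w\<close> (\<open>lightning_strike\<close>). Given a difference \<open>e\<close>, the identity of the
    sum of the two triangles can be perturbed by \<open>e\<close> in its third component; the result is an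
    isomorphism, hence distinguished, and the lightning axiom on the sum compares it with the
    identity.

  A change of \<open>h\<close> by \<open>v' \<theta> w\<close> does not change the isomorphism class of the cone: it is undone by
  the shear of \<open>b' \<oplus> c\<close> with entry \<open>\<theta> w\<close> (\<open>cone_perturb\<close>). So the cone of \<open>h\<close> is isomorphic to
  that of \<open>h0\<close>.

  The standard properties of triangulated categories that enter (vanishing composites, weak kernels
  and cokernels, sums, the octahedron) are derived from the axioms on rotations,
  faces, degeneracies and bases.
\<close>

section \<open>Calculus of morphisms\<close>

text \<open>
  The operations are restated with side conditions on \<open>src\<close> and \<open>tgt\<close>, so that the simplifier can
  discharge them: unlike membership in \<open>Hom\<close>, they do not require it to guess the objects in the
  middle of a composite.
\<close>

context shifted_additive_category
begin

lemma Hom_iff: "f \<in> Hom C a b \<longleftrightarrow> f \<in> Arr C \<and> src C f = a \<and> tgt C f = b"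
  by (auto simp: Hom_def)

lemma arr_ident [simp]:
  assumes "a \<in> Obj C"
  shows "ident C a \<in> Arr C" "src C (ident C a) = a" "tgt C (ident C a) = a"
  using ident_hom[OF assms] by (auto simp: Hom_iff)

lemma arr_cmp [simp]:
  assumes "f \<in> Arr C" "g \<in> Arr C" "src C g = tgt C f"
  shows "g \<cdot> f \<in> Arr C" "src C (g \<cdot> f) = src C f" "tgt C (g \<cdot> f) = tgt C g"
  using cmp_hom[of f "src C f" "tgt C f" g "tgt C g"] assms by (auto simp: Hom_iff)

lemma cmp_ident [simp]:
  assumes "f \<in> Arr C"
  shows "src C f = a \<Longrightarrow> f \<cdot> ident C a = f" "tgt C f = b \<Longrightarrow> ident C b \<cdot> f = f"
  using cmp_ident_right[of f a] cmp_ident_left[of f _ b] assms by (auto simp: Hom_iff)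

lemma cmp_assoc_arr [simp]:
  assumes "f \<in> Arr C" "g \<in> Arr C" "h \<in> Arr C" "src C g = tgt C f" "src C h = tgt C g"
  shows "(h \<cdot> g) \<cdot> f = h \<cdot> (g \<cdot> f)"
  using cmp_assoc[of f "src C f" "tgt C f" g "tgt C g" h "tgt C h"] assms by (auto simp: Hom_iff)

text \<open>Composites are normalised to nest on the right; this applies an equation for \<open>g \<cdot> f\<close> inside such a composite.\<close>

lemma cmp_reassoc:
  assumes "g \<cdot> f = k"
    and "f \<in> Arr C" "g \<in> Arr C" "src C g = tgt C f" "x \<in> Arr C" "src C f = tgt C x"
  shows "g \<cdot> (f \<cdot> x) = k \<cdot> x"
  using assms cmp_assoc_arr[of x f g] by simp

declare src_ob [simp] tgt_ob [simp]

lemma sho_obj [simp]: "a \<in> Obj C \<Longrightarrow> sho C a \<in> Obj C"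
  using sho_bij by (auto simp: bij_betw_def)

lemma zero_obj [simp]: "zero_ob C \<in> Obj C"
  using zero_ob by (auto simp: zero_object_def)

lemma arr_madd [simp]:
  assumes "f \<in> Arr C" "g \<in> Arr C" "src C g = src C f" "tgt C g = tgt C f"
  shows "f \<boxplus> g \<in> Arr C" "src C (f \<boxplus> g) = src C f" "tgt C (f \<boxplus> g) = tgt C f"
proof -
  interpret G: comm_group "hom_group C (src C f) (tgt C f)"
    using hom_comm_group assms by simp
  have "f \<boxplus> g \<in> Hom C (src C f) (tgt C f)"
    using G.m_closed[of f g] assms by (simp add: hom_group_def Hom_iff)
  then show "f \<boxplus> g \<in> Arr C" "src C (f \<boxplus> g) = src C f" "tgt C (f \<boxplus> g) = tgt C f"
    by (auto simp: Hom_iff)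
qed

lemma arr_mzero [simp]:
  assumes "a \<in> Obj C" "b \<in> Obj C"
  shows "mzero C a b \<in> Arr C" "src C (mzero C a b) = a" "tgt C (mzero C a b) = b"
proof -
  interpret G: comm_group "hom_group C a b"
    using hom_comm_group assms by simp
  show "mzero C a b \<in> Arr C" "src C (mzero C a b) = a" "tgt C (mzero C a b) = b"
    using G.one_closed by (auto simp: hom_group_def Hom_iff)
qed

lemma arr_mneg [simp]:
  assumes "f \<in> Arr C"
  shows "mneg C f \<in> Arr C" "src C (mneg C f) = src C f" "tgt C (mneg C f) = tgt C f"
proof -
  interpret G: comm_group "hom_group C (src C f) (tgt C f)"
    using hom_comm_group assms by simp
  have "mneg C f \<in> Hom C (src C f) (tgt C f)"
    using G.inv_closed[of f] assms by (simp add: hom_group_def Hom_iff mneg_def)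
  then show "mneg C f \<in> Arr C" "src C (mneg C f) = src C f" "tgt C (mneg C f) = tgt C f"
    by (auto simp: Hom_iff)
qed

lemma madd_mzero [simp]:
  assumes "f \<in> Arr C" "src C f = a" "tgt C f = b"
  shows "f \<boxplus> mzero C a b = f" "mzero C a b \<boxplus> f = f"
proof -
  interpret G: comm_group "hom_group C a b"
    using hom_comm_group assms by (metis src_ob tgt_ob)
  show "f \<boxplus> mzero C a b = f" "mzero C a b \<boxplus> f = f"
    using G.l_one[of f] G.r_one[of f] assms by (auto simp: hom_group_def Hom_iff)
qed

lemma madd_mneg [simp]:
  assumes "f \<in> Arr C"
  shows "f \<boxplus> mneg C f = mzero C (src C f) (tgt C f)" "mneg C f \<boxplus> f = mzero C (src C f) (tgt C f)"
proof -
  interpret G: comm_group "hom_group C (src C f) (tgt C f)"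
    using hom_comm_group assms by simp
  show "f \<boxplus> mneg C f = mzero C (src C f) (tgt C f)" "mneg C f \<boxplus> f = mzero C (src C f) (tgt C f)"
    using G.l_inv[of f] G.r_inv[of f] assms by (auto simp: hom_group_def Hom_iff mneg_def)
qed

lemma madd_assoc:
  assumes "f \<in> Arr C" "g \<in> Arr C" "h \<in> Arr C"
    "src C g = src C f" "tgt C g = tgt C f" "src C h = src C f" "tgt C h = tgt C f"
  shows "(f \<boxplus> g) \<boxplus> h = f \<boxplus> (g \<boxplus> h)"
proof -
  interpret G: comm_group "hom_group C (src C f) (tgt C f)"
    using hom_comm_group assms by simp
  show ?thesis
    using G.m_assoc[of f g h] assms by (simp add: hom_group_def Hom_iff)
qed

lemma madd_commute:
  assumes "f \<in> Arr C" "g \<in> Arr C" "src C g = src C f" "tgt C g = tgt C f"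
  shows "f \<boxplus> g = g \<boxplus> f"
proof -
  interpret G: comm_group "hom_group C (src C f) (tgt C f)"
    using hom_comm_group assms by simp
  show ?thesis
    using G.m_comm[of f g] assms by (simp add: hom_group_def Hom_iff)
qed

lemma madd_left_commute:
  assumes "f \<in> Arr C" "g \<in> Arr C" "h \<in> Arr C"
    "src C g = src C f" "tgt C g = tgt C f" "src C h = src C f" "tgt C h = tgt C f"
  shows "f \<boxplus> (g \<boxplus> h) = g \<boxplus> (f \<boxplus> h)"
  using assms madd_assoc[of f g h] madd_assoc[of g f h] madd_commute[of f g] by simp

lemmas madd_ac = madd_assoc madd_commute madd_left_commute

lemma madd_mneg_cancel [simp]:
  assumes "f \<in> Arr C" "g \<in> Arr C" "src C g = src C f" "tgt C g = tgt C f"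
  shows "f \<boxplus> (mneg C f \<boxplus> g) = g" "mneg C f \<boxplus> (f \<boxplus> g) = g"
  using assms madd_assoc[of f "mneg C f" g] madd_assoc[of "mneg C f" f g] by simp_all

lemma mneg_unique:
  assumes "f \<in> Arr C" "g \<in> Arr C" "src C g = src C f" "tgt C g = tgt C f"
    and "f \<boxplus> g = mzero C (src C f) (tgt C f)"
  shows "g = mneg C f"
  using assms madd_mneg_cancel(2)[of f g] by simp

lemma eq_if_diff_zero:
  assumes "f \<in> Arr C" "g \<in> Arr C" "src C g = src C f" "tgt C g = tgt C f"
    and "f \<boxplus> mneg C g = mzero C (src C f) (tgt C f)"
  shows "f = g"
proof -
  have "f = (f \<boxplus> mneg C g) \<boxplus> g"
    using assms(1-4) by (simp add: madd_assoc)
  then show ?thesis using assms by simp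
qed

lemma mneg_mneg [simp]: "f \<in> Arr C \<Longrightarrow> mneg C (mneg C f) = f"
  using mneg_unique[of "mneg C f" f] by simp

lemma mneg_mzero [simp]: "a \<in> Obj C \<Longrightarrow> b \<in> Obj C \<Longrightarrow> mneg C (mzero C a b) = mzero C a b"
  using mneg_unique[of "mzero C a b" "mzero C a b"] by simp

lemma mneg_madd [simp]:
  assumes "f \<in> Arr C" "g \<in> Arr C" "src C g = src C f" "tgt C g = tgt C f"
  shows "mneg C (f \<boxplus> g) = mneg C f \<boxplus> mneg C g"
  using assms by (intro mneg_unique[symmetric]) (simp_all add: madd_ac)

lemma cmp_madd [simp]:
  assumes "f \<in> Arr C" "f' \<in> Arr C" "src C f' = src C f" "tgt C f' = tgt C f" "g \<in> Arr C"
  shows "src C g = tgt C f \<Longrightarrow> g \<cdot> (f \<boxplus> f') = (g \<cdot> f) \<boxplus> (g \<cdot> f')"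
    "tgt C g = src C f \<Longrightarrow> (f \<boxplus> f') \<cdot> g = (f \<cdot> g) \<boxplus> (f' \<cdot> g)"
  using assms cmp_madd_right[of f "src C f" "tgt C f" f' g "tgt C g"]
    cmp_madd_left[of g "src C g" "src C f" f "tgt C f" f'] by (auto simp: Hom_iff)

text \<open>The source of all vanishing statements for the operations: an additive operation sends zero to
  an element equal to its double.\<close>

lemma madd_self_zero:
  assumes "f \<in> Arr C" "f \<boxplus> f = f"
  shows "f = mzero C (src C f) (tgt C f)"
  using assms madd_mneg_cancel(2)[of f f] by simp

lemma cmp_mzero [simp]:
  assumes "f \<in> Arr C"
  shows "src C f = b \<Longrightarrow> a \<in> Obj C \<Longrightarrow> f \<cdot> mzero C a b = mzero C a (tgt C f)"
    "tgt C f = a \<Longrightarrow> b \<in> Obj C \<Longrightarrow> mzero C a b \<cdot> f = mzero C (src C f) b"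
proof -
  show "f \<cdot> mzero C a b = mzero C a (tgt C f)" if "src C f = b" "a \<in> Obj C"
  proof -
    have b: "b \<in> Obj C" using that assms by auto
    have "f \<cdot> mzero C a b \<boxplus> f \<cdot> mzero C a b = f \<cdot> mzero C a b"
      using that b assms by (simp flip: cmp_madd)
    then show ?thesis
      using that b assms madd_self_zero[of "f \<cdot> mzero C a b"] by simp
  qed
  show "mzero C a b \<cdot> f = mzero C (src C f) b" if "tgt C f = a" "b \<in> Obj C"
  proof -
    have a: "a \<in> Obj C" using that assms by auto
    have "mzero C a b \<cdot> f \<boxplus> mzero C a b \<cdot> f = mzero C a b \<cdot> f"
      using that a assms by (subst cmp_madd(2)[symmetric]) simp_all
    then show ?thesis
      using that a assms madd_self_zero[of "mzero C a b \<cdot> f"] by simp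
  qed
qed

lemma cmp_mneg [simp]:
  assumes "f \<in> Arr C" "g \<in> Arr C" "src C g = tgt C f"
  shows "g \<cdot> mneg C f = mneg C (g \<cdot> f)" "mneg C g \<cdot> f = mneg C (g \<cdot> f)"
proof -
  have "(g \<cdot> f) \<boxplus> (g \<cdot> mneg C f) = mzero C (src C f) (tgt C g)"
    using assms by (simp flip: cmp_madd)
  then show "g \<cdot> mneg C f = mneg C (g \<cdot> f)"
    using assms by (intro mneg_unique) simp_all
  have "(g \<cdot> f) \<boxplus> (mneg C g \<cdot> f) = mzero C (src C f) (tgt C g)"
    using assms by (simp flip: cmp_madd)
  then show "mneg C g \<cdot> f = mneg C (g \<cdot> f)"
    using assms by (intro mneg_unique) simp_all
qed

lemma arr_sha [simp]:
  assumes "f \<in> Arr C"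
  shows "sha C f \<in> Arr C" "src C (sha C f) = sho C (src C f)" "tgt C (sha C f) = sho C (tgt C f)"
  using sha_hom[of f "src C f" "tgt C f"] assms by (auto simp: Hom_iff)

declare sha_ident [simp]

lemma sha_cmp_arr [simp]:
  "f \<in> Arr C \<Longrightarrow> g \<in> Arr C \<Longrightarrow> src C g = tgt C f \<Longrightarrow> sha C (g \<cdot> f) = sha C g \<cdot> sha C f"
  using sha_cmp[of f "src C f" "tgt C f" g "tgt C g"] by (auto simp: Hom_iff)

lemma sha_madd_arr [simp]:
  "f \<in> Arr C \<Longrightarrow> g \<in> Arr C \<Longrightarrow> src C g = src C f \<Longrightarrow> tgt C g = tgt C f
    \<Longrightarrow> sha C (f \<boxplus> g) = sha C f \<boxplus> sha C g"
  using sha_madd[of f "src C f" "tgt C f" g] by (auto simp: Hom_iff)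

lemma sha_mzero [simp]:
  assumes "a \<in> Obj C" "b \<in> Obj C"
  shows "sha C (mzero C a b) = mzero C (sho C a) (sho C b)"
proof -
  have "sha C (mzero C a b) \<boxplus> sha C (mzero C a b) = sha C (mzero C a b)"
    using assms by (simp flip: sha_madd_arr)
  then show ?thesis using assms madd_self_zero[of "sha C (mzero C a b)"] by simp
qed

lemma sha_mneg [simp]:
  assumes "f \<in> Arr C"
  shows "sha C (mneg C f) = mneg C (sha C f)"
proof -
  have "sha C f \<boxplus> sha C (mneg C f) = mzero C (sho C (src C f)) (sho C (tgt C f))"
    using assms by (simp flip: sha_madd_arr)
  then show ?thesis using assms by (intro mneg_unique) simp_all
qed

lemma sha_eq_iff [simp]: "f \<in> Arr C \<Longrightarrow> g \<in> Arr C \<Longrightarrow> sha C f = sha C g \<longleftrightarrow> f = g"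
  using sha_bij by (auto simp: bij_betw_def inj_on_def)

lemma mneg_eq_iff [simp]: "f \<in> Arr C \<Longrightarrow> g \<in> Arr C \<Longrightarrow> mneg C f = mneg C g \<longleftrightarrow> f = g"
  by (metis mneg_mneg)

text \<open>Weak kernels are obtained from rotated triangles and hence one shift too high; fullness of the
  shift brings them back.\<close>

lemma sha_full:
  assumes "t \<in> Hom C (sho C a) (sho C b)" "a \<in> Obj C" "b \<in> Obj C"
  obtains s where "s \<in> Hom C a b" "t = sha C s"
proof -
  have "t \<in> sha C ` Arr C" using sha_bij assms by (auto simp: bij_betw_def Hom_iff)
  then obtain s where s: "s \<in> Arr C" "t = sha C s" by auto
  have "sho C (src C s) = sho C a" "sho C (tgt C s) = sho C b"
    using s assms by (auto simp: Hom_iff)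
  then have "src C s = a" "tgt C s = b"
    using sho_bij assms s by (auto simp: bij_betw_def inj_on_def)
  then show ?thesis using s that by (auto simp: Hom_iff)
qed

lemma ident_zero [simp]: "ident C (zero_ob C) = mzero C (zero_ob C) (zero_ob C)"
proof -
  have "\<exists>!f. f \<in> Hom C (zero_ob C) (zero_ob C)"
    using zero_ob by (auto simp: zero_object_def)
  moreover have "ident C (zero_ob C) \<in> Hom C (zero_ob C) (zero_ob C)"
      "mzero C (zero_ob C) (zero_ob C) \<in> Hom C (zero_ob C) (zero_ob C)"
    by (simp_all add: Hom_iff)
  ultimately show ?thesis by blast
qed

section \<open>Isomorphisms\<close>

definition inverses :: "'o \<Rightarrow> 'o \<Rightarrow> 'm \<Rightarrow> 'm \<Rightarrow> bool" where
  "inverses a b f f' \<longleftrightarrow> f \<in> Hom C a b \<and> f' \<in> Hom C b a \<and> f' \<cdot> f = ident C a \<and> f \<cdot> f' = ident C b"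

lemma inverses_ident: "a \<in> Obj C \<Longrightarrow> inverses a a (ident C a) (ident C a)"
  by (simp add: inverses_def Hom_iff)

lemma inverses_sym: "inverses a b f f' \<Longrightarrow> inverses b a f' f"
  by (simp add: inverses_def)

lemma inverses_natural:
  assumes f: "inverses a b f f'" and g: "inverses c d g g'"
    and u: "u \<in> Hom C a c" and v: "v \<in> Hom C b d" and eq: "g \<cdot> u = v \<cdot> f"
  shows "g' \<cdot> v = u \<cdot> f'"
proof -
  have 1: "g' \<cdot> (g \<cdot> (u \<cdot> f')) = u \<cdot> f'"
    using f g u cmp_reassoc[of g' g "ident C c" "u \<cdot> f'"] by (simp add: inverses_def Hom_iff)
  have "g' \<cdot> v = g' \<cdot> (v \<cdot> (f \<cdot> f'))"
    using f v by (simp add: inverses_def Hom_iff)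
  also have "\<dots> = g' \<cdot> ((g \<cdot> u) \<cdot> f')"
    using f g v u by (simp add: eq inverses_def Hom_iff)
  also have "\<dots> = u \<cdot> f'"
    using 1 f g u by (simp add: inverses_def Hom_iff)
  finally show ?thesis .
qed

text \<open>A form of the five lemma. Both \<open>l \<cdot> k\<close> and \<open>k \<cdot> l\<close> differ from the identity by a map \<open>d\<close> with \<open>d v = 0\<close>
  and \<open>w d = 0\<close>. The first equation gives \<open>d = \<beta> w\<close>, and then \<open>d d = \<beta> (w d) = 0\<close>, so that \<open>1 + d\<close> has
  the inverse \<open>1 - d\<close>. Only the weak cokernel property of the two rows enters, because the lemma is
  also applied to a row that is not yet known to be distinguished.\<close>

lemma comparison_iso:
  assumes k: "k \<in> Hom C c c'" and l: "l \<in> Hom C c' c"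
    and v: "v \<in> Hom C b c" and w: "w \<in> Hom C c e" and v': "v' \<in> Hom C b c'" and w': "w' \<in> Hom C c' e"
    and kv: "k \<cdot> v = v'" and kw: "w' \<cdot> k = w" and lv: "l \<cdot> v' = v" and lw: "w \<cdot> l = w'"
    and wc: "\<And>f. f \<in> Hom C c c \<Longrightarrow> f \<cdot> v = mzero C b c \<Longrightarrow> \<exists>\<beta> \<in> Hom C e c. f = \<beta> \<cdot> w"
    and wc': "\<And>f. f \<in> Hom C c' c' \<Longrightarrow> f \<cdot> v' = mzero C b c' \<Longrightarrow> \<exists>\<beta> \<in> Hom C e c'. f = \<beta> \<cdot> w'"
  obtains k' where "inverses c c' k k'"
proof -
  have ob: "c \<in> Obj C" "c' \<in> Obj C" "b \<in> Obj C" "e \<in> Obj C"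
    using k v w src_ob tgt_ob by (auto simp: Hom_iff)
  have *: "\<exists>m \<in> Hom C x x. n \<cdot> m = ident C x \<and> m \<cdot> n = ident C x"
    if n: "n \<in> Hom C x x" and p: "p \<in> Hom C b x" and q: "q \<in> Hom C x e" and np: "n \<cdot> p = p" and qn: "q \<cdot> n = q"
      and wc: "\<And>f. f \<in> Hom C x x \<Longrightarrow> f \<cdot> p = mzero C b x \<Longrightarrow> \<exists>\<beta> \<in> Hom C e x. f = \<beta> \<cdot> q"
    for n x p q
  proof -
    have x: "x \<in> Obj C" using n src_ob by (auto simp: Hom_iff)
    define d where "d = n \<boxplus> mneg C (ident C x)"
    have d: "d \<in> Hom C x x" using n x by (simp add: d_def Hom_iff)
    have "d \<cdot> p = mzero C b x" "q \<cdot> d = mzero C x e"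
      using n p q x ob np qn by (simp_all add: d_def Hom_iff)
    then obtain \<beta> where \<beta>: "\<beta> \<in> Hom C e x" "d = \<beta> \<cdot> q" using wc[OF d] by auto
    then have "d \<cdot> d = \<beta> \<cdot> (q \<cdot> d)" using q d by (simp add: Hom_iff)
    then have dd: "d \<cdot> d = mzero C x x" using \<open>q \<cdot> d = _\<close> \<beta> x by (simp add: Hom_iff)
    have n_eq: "n = ident C x \<boxplus> d" using n x by (simp add: d_def Hom_iff madd_ac)
    have "n \<cdot> (ident C x \<boxplus> mneg C d) = ident C x" "(ident C x \<boxplus> mneg C d) \<cdot> n = ident C x"
      using d x dd by (simp_all add: n_eq Hom_iff madd_ac)
    then show ?thesis using d x by (intro bexI[of _ "ident C x \<boxplus> mneg C d"]) (auto simp: Hom_iff)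
  qed
  have lk: "l \<cdot> k \<in> Hom C c c" "k \<cdot> l \<in> Hom C c' c'" using k l by (simp_all add: Hom_iff)
  have "(l \<cdot> k) \<cdot> v = v" "w \<cdot> (l \<cdot> k) = w" "(k \<cdot> l) \<cdot> v' = v'" "w' \<cdot> (k \<cdot> l) = w'"
    using k l v w v' w' kv kw lv lw cmp_reassoc[OF lw, of k] cmp_reassoc[OF kw, of l] by (auto simp: Hom_iff)
  then obtain m m' where m: "m \<in> Hom C c c" "(l \<cdot> k) \<cdot> m = ident C c" "m \<cdot> (l \<cdot> k) = ident C c"
    and m': "m' \<in> Hom C c' c'" "(k \<cdot> l) \<cdot> m' = ident C c'" "m' \<cdot> (k \<cdot> l) = ident C c'"
    using *[OF lk(1) v w _ _ wc] *[OF lk(2) v' w' _ _ wc'] by metis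
  have mlk: "(m \<cdot> l) \<cdot> k = ident C c" using m k l by (simp add: Hom_iff)
  have "m \<cdot> l = (m \<cdot> l) \<cdot> ((k \<cdot> l) \<cdot> m')" using m m' l by (simp add: Hom_iff)
  also have "\<dots> = (m \<cdot> (l \<cdot> k)) \<cdot> (l \<cdot> m')" using m(1) m'(1) k l by (simp add: Hom_iff)
  also have "\<dots> = l \<cdot> m'" using m m' l ob by (simp add: Hom_iff)
  finally have "k \<cdot> (m \<cdot> l) = ident C c'"
    using m' k l by (simp add: Hom_iff)
  then have "inverses c c' k (m \<cdot> l)"
    using m mlk k l by (simp add: inverses_def Hom_iff)
  then show ?thesis using that by blast
qed

section \<open>Biproducts and matrices\<close>

text \<open>The composites with a further arrow \<open>x\<close> are included because the simplifier normalises composites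
  to the right and then no longer sees \<open>pr1 P \<cdot> in1 P\<close>.\<close>

lemma biprod_facts:
  assumes "is_biproduct C a b P"
  shows "a \<in> Obj C" "b \<in> Obj C" "sum_ob P \<in> Obj C"
    "in1 P \<in> Arr C" "src C (in1 P) = a" "tgt C (in1 P) = sum_ob P"
    "in2 P \<in> Arr C" "src C (in2 P) = b" "tgt C (in2 P) = sum_ob P"
    "pr1 P \<in> Arr C" "src C (pr1 P) = sum_ob P" "tgt C (pr1 P) = a"
    "pr2 P \<in> Arr C" "src C (pr2 P) = sum_ob P" "tgt C (pr2 P) = b"
    "pr1 P \<cdot> in1 P = ident C a" "pr2 P \<cdot> in2 P = ident C b"
    "pr1 P \<cdot> in2 P = mzero C b a" "pr2 P \<cdot> in1 P = mzero C a b"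
    "\<And>x. x \<in> Arr C \<Longrightarrow> tgt C x = a \<Longrightarrow> pr1 P \<cdot> (in1 P \<cdot> x) = x"
    "\<And>x. x \<in> Arr C \<Longrightarrow> tgt C x = b \<Longrightarrow> pr2 P \<cdot> (in2 P \<cdot> x) = x"
    "\<And>x. x \<in> Arr C \<Longrightarrow> tgt C x = b \<Longrightarrow> pr1 P \<cdot> (in2 P \<cdot> x) = mzero C (src C x) a"
    "\<And>x. x \<in> Arr C \<Longrightarrow> tgt C x = a \<Longrightarrow> pr2 P \<cdot> (in1 P \<cdot> x) = mzero C (src C x) b"
proof -
  show *: "a \<in> Obj C" "b \<in> Obj C" "sum_ob P \<in> Obj C"
    "in1 P \<in> Arr C" "src C (in1 P) = a" "tgt C (in1 P) = sum_ob P"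
    "in2 P \<in> Arr C" "src C (in2 P) = b" "tgt C (in2 P) = sum_ob P"
    "pr1 P \<in> Arr C" "src C (pr1 P) = sum_ob P" "tgt C (pr1 P) = a"
    "pr2 P \<in> Arr C" "src C (pr2 P) = sum_ob P" "tgt C (pr2 P) = b"
    "pr1 P \<cdot> in1 P = ident C a" "pr2 P \<cdot> in2 P = ident C b"
    "pr1 P \<cdot> in2 P = mzero C b a" "pr2 P \<cdot> in1 P = mzero C a b"
    using assms by (auto simp: is_biproduct_def Hom_iff)
  show "pr1 P \<cdot> (in1 P \<cdot> x) = x" if "x \<in> Arr C" "tgt C x = a" for x
    using that * by (simp add: cmp_reassoc)
  show "pr2 P \<cdot> (in2 P \<cdot> x) = x" if "x \<in> Arr C" "tgt C x = b" for x
    using that * by (simp add: cmp_reassoc)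
  show "pr1 P \<cdot> (in2 P \<cdot> x) = mzero C (src C x) a" if "x \<in> Arr C" "tgt C x = b" for x
    using that * by (simp add: cmp_reassoc)
  show "pr2 P \<cdot> (in1 P \<cdot> x) = mzero C (src C x) b" if "x \<in> Arr C" "tgt C x = a" for x
    using that * by (simp add: cmp_reassoc)
qed

lemma biprod_sum:
  assumes "is_biproduct C a b P"
  shows "in1 P \<cdot> pr1 P \<boxplus> in2 P \<cdot> pr2 P = ident C (sum_ob P)"
  using assms by (simp add: is_biproduct_def)

lemma biprod_eqI_dom:
  assumes P: "is_biproduct C a b P"
    and "f \<in> Arr C" "g \<in> Arr C" "src C f = sum_ob P" "src C g = sum_ob P" "tgt C f = tgt C g"
    and "f \<cdot> in1 P = g \<cdot> in1 P" "f \<cdot> in2 P = g \<cdot> in2 P"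
  shows "f = g"
proof -
  note bp = biprod_facts[OF P]
  have *: "x = (x \<cdot> in1 P) \<cdot> pr1 P \<boxplus> (x \<cdot> in2 P) \<cdot> pr2 P"
    if "x \<in> Arr C" "src C x = sum_ob P" for x
  proof -
    have "x = x \<cdot> (in1 P \<cdot> pr1 P \<boxplus> in2 P \<cdot> pr2 P)"
      using that biprod_sum[OF P] by simp
    then show ?thesis using that by (simp add: bp)
  qed
  show ?thesis
    using *[of f] *[of g] assms by simp
qed

lemma biprod_eqI_cod:
  assumes P: "is_biproduct C a b P"
    and "f \<in> Arr C" "g \<in> Arr C" "tgt C f = sum_ob P" "tgt C g = sum_ob P" "src C f = src C g"
    and "pr1 P \<cdot> f = pr1 P \<cdot> g" "pr2 P \<cdot> f = pr2 P \<cdot> g"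
  shows "f = g"
proof -
  note bp = biprod_facts[OF P]
  have *: "x = in1 P \<cdot> (pr1 P \<cdot> x) \<boxplus> in2 P \<cdot> (pr2 P \<cdot> x)"
    if "x \<in> Arr C" "tgt C x = sum_ob P" for x
  proof -
    have "x = (in1 P \<cdot> pr1 P \<boxplus> in2 P \<cdot> pr2 P) \<cdot> x"
      using that biprod_sum[OF P] by simp
    then show ?thesis using that by (simp add: bp)
  qed
  show ?thesis
    using *[of f] *[of g] assms by simp
qed

lemma mat2_facts:
  assumes P: "is_biproduct C a b P" and Q: "is_biproduct C a' b' Q"
    and "p \<in> Hom C a a'" "q \<in> Hom C b a'" "r \<in> Hom C a b'" "s \<in> Hom C b b'"
  shows "mat2 C P Q p q r s \<in> Arr C" "src C (mat2 C P Q p q r s) = sum_ob P"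
    "tgt C (mat2 C P Q p q r s) = sum_ob Q"
    "mat2 C P Q p q r s \<cdot> in1 P = in1 Q \<cdot> p \<boxplus> in2 Q \<cdot> r"
    "mat2 C P Q p q r s \<cdot> in2 P = in1 Q \<cdot> q \<boxplus> in2 Q \<cdot> s"
    "pr1 Q \<cdot> mat2 C P Q p q r s = p \<cdot> pr1 P \<boxplus> q \<cdot> pr2 P"
    "pr2 Q \<cdot> mat2 C P Q p q r s = r \<cdot> pr1 P \<boxplus> s \<cdot> pr2 P"
  using assms(3-6) by (simp_all add: mat2_def biprod_facts[OF P] biprod_facts[OF Q] Hom_iff)

lemma shift_biprod_simps [simp]:
  "sum_ob (shift_biprod C P) = sho C (sum_ob P)"
  "in1 (shift_biprod C P) = sha C (in1 P)" "in2 (shift_biprod C P) = sha C (in2 P)"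
  "pr1 (shift_biprod C P) = sha C (pr1 P)" "pr2 (shift_biprod C P) = sha C (pr2 P)"
  by (simp_all add: shift_biprod_def)

lemma is_biproduct_shift:
  assumes P: "is_biproduct C a b P"
  shows "is_biproduct C (sho C a) (sho C b) (shift_biprod C P)"
  using biprod_sum[OF P, THEN arg_cong[where f = "sha C"]]
  by (simp add: is_biproduct_def Hom_iff biprod_facts[OF P] flip: sha_cmp_arr sha_madd_arr)

lemma diagonal_pr:
  assumes P: "is_biproduct C a a' P" and Q: "is_biproduct C b b' Q"
    and u: "u \<in> Hom C a b" "u' \<in> Hom C a' b'" and U: "U \<in> Hom C (sum_ob P) (sum_ob Q)"
    and eqs: "U \<cdot> in1 P = in1 Q \<cdot> u" "U \<cdot> in2 P = in2 Q \<cdot> u'"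
  shows "pr1 Q \<cdot> U = u \<cdot> pr1 P" "pr2 Q \<cdot> U = u' \<cdot> pr2 P"
  by (rule biprod_eqI_dom[OF P],
      use u U in \<open>simp_all add: Hom_iff biprod_facts[OF P] biprod_facts[OF Q] eqs\<close>)+

text \<open>With these biproducts, the sum of a triangle with a contractible one has the expected
  third vertex and not merely an isomorphic one.\<close>

lemma is_biproduct_zero:
  assumes "c \<in> Obj C"
  shows "is_biproduct C c (zero_ob C) \<lparr>sum_ob = c, in1 = ident C c, in2 = mzero C (zero_ob C) c,
      pr1 = ident C c, pr2 = mzero C c (zero_ob C)\<rparr>"
    and "is_biproduct C (zero_ob C) c \<lparr>sum_ob = c, in1 = mzero C (zero_ob C) c, in2 = ident C c,
      pr1 = mzero C c (zero_ob C), pr2 = ident C c\<rparr>"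
  using assms by (simp_all add: is_biproduct_def Hom_iff)

text \<open>The same object as a biproduct in sheared coordinates: a triangular matrix becomes
  diagonal, so that it can be treated as a sum of maps.\<close>

lemma is_biproduct_shear:
  assumes X: "is_biproduct C a b X" and g: "g \<in> Hom C b a"
  shows "is_biproduct C a b \<lparr>sum_ob = sum_ob X, in1 = in1 X, in2 = in1 X \<cdot> g \<boxplus> in2 X,
      pr1 = pr1 X \<boxplus> mneg C (g \<cdot> pr2 X), pr2 = pr2 X\<rparr>"
  using g biprod_sum[OF X]
  by (simp add: is_biproduct_def Hom_iff biprod_facts[OF X] madd_ac)

lemma biprod_inverses:
  assumes B: "is_biproduct C a b B" and R: "is_biproduct C a b R"
  shows "inverses (sum_ob B) (sum_ob R) (in1 R \<cdot> pr1 B \<boxplus> in2 R \<cdot> pr2 B) (in1 B \<cdot> pr1 R \<boxplus> in2 B \<cdot> pr2 R)"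
  using biprod_sum[OF B] biprod_sum[OF R]
  by (simp add: inverses_def Hom_iff biprod_facts[OF B] biprod_facts[OF R])

end

section \<open>Triangles and their maps in coordinates\<close>

lemma le2_cases: "i < j \<and> j \<le> 2 \<longleftrightarrow> (i = 0 \<and> j = Suc 0) \<or> (i = 0 \<and> j = 2) \<or> (i = Suc 0 \<and> j = 2)"
  for i j :: nat
  by auto

lemma restr_tri_2:
  "restr_tri 2 A = tri2 (vert A 0 1) (vert A 0 2) (vert A 1 2)
     (edge1 A 0 1 2) (edge2 A 0 1 2) (edge3 A 0 1 2)"
proof -
  have 3: "i < j \<and> j < k \<and> k \<le> 2 \<longleftrightarrow> i = 0 \<and> j = Suc 0 \<and> k = 2" for i j k :: nat
    by auto
  show ?thesis
    by (auto simp: tri2_def restr_tri_def restr2_def restr3_def le2_cases 3 fun_eq_iff)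
qed

lemma restr2_2: "restr2 2 \<phi> = tri2_map (\<phi> 0 1) (\<phi> 0 2) (\<phi> 1 2)"
  by (auto simp: tri2_map_def restr2_def le2_cases fun_eq_iff)

lemma face_3: "face 3 m A = tri2 (vert A (skip m 0) (skip m 1)) (vert A (skip m 0) (skip m 2))
    (vert A (skip m 1) (skip m 2)) (edge1 A (skip m 0) (skip m 1) (skip m 2))
    (edge2 A (skip m 0) (skip m 1) (skip m 2)) (edge3 A (skip m 0) (skip m 1) (skip m 2))"
  by (simp add: face_def restr_tri_2)

lemma restr_tri_simps [simp]:
  "vert (restr_tri n A) = restr2 n (vert A)" "edge1 (restr_tri n A) = restr3 n (edge1 A)"
  "edge2 (restr_tri n A) = restr3 n (edge2 A)" "edge3 (restr_tri n A) = restr3 n (edge3 A)"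
  by (simp_all add: restr_tri_def)

lemma tri2_simps [simp]:
  "vert (tri2 a b c u v w) 0 (Suc 0) = a" "vert (tri2 a b c u v w) 0 2 = b"
  "vert (tri2 a b c u v w) (Suc 0) 2 = c"
  "edge1 (tri2 a b c u v w) 0 (Suc 0) 2 = u" "edge2 (tri2 a b c u v w) 0 (Suc 0) 2 = v"
  "edge3 (tri2 a b c u v w) 0 (Suc 0) 2 = w"
  by (simp_all add: tri2_def restr_tri_def restr2_def restr3_def)

lemma tri2_map_simps [simp]:
  "tri2_map f g h 0 (Suc 0) = f" "tri2_map f g h 0 2 = g" "tri2_map f g h (Suc 0) 2 = h"
  by (simp_all add: tri2_map_def restr2_def)

text \<open>The only index triple is \<open>0 < 1 < 2\<close>; the last equation makes the star and square conditions, which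
  involve four indices, vacuous.\<close>

lemma all_le2:
  "(\<forall>i j. i < j \<and> j \<le> 2 \<longrightarrow> R i j) \<longleftrightarrow> R 0 (Suc 0) \<and> R 0 2 \<and> R (Suc 0) 2"
  "(\<forall>i j k. i < j \<and> j < k \<and> k \<le> 2 \<longrightarrow> R' i j k) \<longleftrightarrow> R' 0 (Suc 0) 2"
  "i < j \<and> j < k \<and> k < l \<and> l \<le> 2 \<longleftrightarrow> False"
  for R :: "nat \<Rightarrow> nat \<Rightarrow> bool" and R' :: "nat \<Rightarrow> nat \<Rightarrow> nat \<Rightarrow> bool" and i j k l :: nat
proof -
  have 3: "i < j \<and> j < k \<and> k \<le> 2 \<longleftrightarrow> i = 0 \<and> j = Suc 0 \<and> k = 2" for i j k :: nat
    by auto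
  show "(\<forall>i j k. i < j \<and> j < k \<and> k \<le> 2 \<longrightarrow> R' i j k) \<longleftrightarrow> R' 0 (Suc 0) 2"
    by (simp add: 3)
  show "(\<forall>i j. i < j \<and> j \<le> 2 \<longrightarrow> R i j) \<longleftrightarrow> R 0 (Suc 0) \<and> R 0 2 \<and> R (Suc 0) 2"
    by (auto simp: le2_cases)
  show "i < j \<and> j < k \<and> k < l \<and> l \<le> 2 \<longleftrightarrow> False"
    by auto
qed

lemma is_tri_tri2:
  "is_tri C 2 (tri2 a b c u v w) \<longleftrightarrow> a \<in> Obj C \<and> b \<in> Obj C \<and> c \<in> Obj C \<and>
     u \<in> Hom C a b \<and> v \<in> Hom C b c \<and> w \<in> Hom C c (sho C a)"
  unfolding is_tri_def restr_tri_2 all_le2 by simp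

lemma tri2_map_in_tri_maps:
  "tri2_map f g h \<in> tri_maps C 2 (tri2 a b c u v w) (tri2 a' b' c' u' v' w') \<longleftrightarrow>
     is_tri C 2 (tri2 a b c u v w) \<and> is_tri C 2 (tri2 a' b' c' u' v' w') \<and>
     f \<in> Hom C a a' \<and> g \<in> Hom C b b' \<and> h \<in> Hom C c c' \<and>
     cmp C g u = cmp C u' f \<and> cmp C h v = cmp C v' g \<and> cmp C (sha C f) w = cmp C w' h"
  unfolding tri_maps_def mem_Collect_eq restr2_2 all_le2 by simp

lemma tri_cmp_tri2_map:
  "tri_cmp C 2 (tri2_map f' g' h') (tri2_map f g h) = tri2_map (cmp C f' f) (cmp C g' g) (cmp C h' h)"
  by (simp add: tri_cmp_def restr2_2)

lemma tri_ident_tri2: "tri_ident C 2 (tri2 a b c u v w) = tri2_map (ident C a) (ident C b) (ident C c)"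
  by (simp add: tri_ident_def restr2_2)

lemma all_simplex_2:
  "(\<forall>i. 1 \<le> i \<and> i \<le> 2 \<longrightarrow> R i) \<longleftrightarrow> R (Suc 0) \<and> R 2"
  "(\<forall>i j. 1 \<le> i \<and> i < j \<and> j \<le> 2 \<longrightarrow> R' i j) \<longleftrightarrow> R' (Suc 0) 2"
  "1 \<le> i \<and> i < j \<and> j < k \<and> k \<le> 2 \<longleftrightarrow> False"
  for R :: "nat \<Rightarrow> bool" and R' :: "nat \<Rightarrow> nat \<Rightarrow> bool" and i j k :: nat
proof -
  have 1: "1 \<le> i \<and> i \<le> 2 \<longleftrightarrow> i = Suc 0 \<or> i = 2" for i :: nat
    by auto
  show "(\<forall>i. 1 \<le> i \<and> i \<le> 2 \<longrightarrow> R i) \<longleftrightarrow> R (Suc 0) \<and> R 2"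
    unfolding 1 by auto
  have 2: "1 \<le> i \<and> i < j \<and> j \<le> 2 \<longleftrightarrow> i = Suc 0 \<and> j = 2" for i j :: nat
    by auto
  show "(\<forall>i j. 1 \<le> i \<and> i < j \<and> j \<le> 2 \<longrightarrow> R' i j) \<longleftrightarrow> R' (Suc 0) 2"
    unfolding 2 by simp
  show "1 \<le> i \<and> i < j \<and> j < k \<and> k \<le> 2 \<longleftrightarrow> False"
    by auto
qed

lemma restr_simplex_idem: "restr_simplex n (restr_simplex n S) = restr_simplex n S"
  by (simp add: restr_simplex_def cong: if_cong)

lemma base_2_simps [simp]:
  "svert (base 2 A) (Suc 0) = vert A 0 1" "svert (base 2 A) 2 = vert A 0 2"
  "sedge (base 2 A) (Suc 0) 2 = edge1 A 0 1 2"
  by (simp_all add: base_def restr_simplex_def)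

lemma is_simplex_base_2:
  assumes "is_tri C 2 A"
  shows "is_simplex C 2 (base 2 A)"
  using assms unfolding is_simplex_def is_tri_def all_le2 all_simplex_2
  by (simp add: base_def restr_simplex_idem del: base_2_simps)
     (simp add: restr_simplex_def)

context shifted_additive_category
begin

text \<open>Componentwise inverses suffice: the inverse family is automatically a map of triangles.\<close>

lemma tri_isosI:
  assumes T: "is_tri C 2 (tri2 a b c u v w)" and T': "is_tri C 2 (tri2 a' b' c' u' v' w')"
    and f: "inverses a a' f f'" and g: "inverses b b' g g'" and h: "inverses c c' h h'"
    and eqs: "g \<cdot> u = u' \<cdot> f" "h \<cdot> v = v' \<cdot> g" "sha C f \<cdot> w = w' \<cdot> h"
  shows "tri2_map f g h \<in> tri_isos C 2 (tri2 a b c u v w) (tri2 a' b' c' u' v' w')"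
proof -
  have ob: "a \<in> Obj C" "a' \<in> Obj C" using T T' by (simp_all add: is_tri_tri2)
  have f1: "inverses (sho C a) (sho C a') (sha C f) (sha C f')"
    using f ob by (simp add: inverses_def Hom_iff flip: sha_cmp_arr)
  have inv: "g' \<cdot> u' = u \<cdot> f'" "h' \<cdot> v' = v \<cdot> g'" "sha C f' \<cdot> w' = w \<cdot> h'"
    using inverses_natural[OF f g _ _ eqs(1)] inverses_natural[OF g h _ _ eqs(2)]
      inverses_natural[OF h f1 _ _ eqs(3)] T T' by (simp_all add: is_tri_tri2)
  show ?thesis
    unfolding tri_isos_def mem_Collect_eq
    using assms inv
    by (intro conjI bexI[of _ "tri2_map f' g' h'"])
      (simp_all add: tri2_map_in_tri_maps tri_cmp_tri2_map tri_ident_tri2 inverses_def)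
qed

end

section \<open>First consequences of the axioms\<close>

context fully_triangulated
begin

lemma tri2_facts:
  assumes "tri2 a b c u v w \<in> D 2"
  shows "a \<in> Obj C" "b \<in> Obj C" "c \<in> Obj C"
    "u \<in> Arr C" "src C u = a" "tgt C u = b"
    "v \<in> Arr C" "src C v = b" "tgt C v = c"
    "w \<in> Arr C" "src C w = c" "tgt C w = sho C a"
  using dist_tri[OF _ assms] by (simp_all add: is_tri_tri2 Hom_iff)

lemma dist_eq_tri2:
  assumes "A \<in> D 2"
  shows "A = tri2 (vert A 0 1) (vert A 0 2) (vert A 1 2)
     (edge1 A 0 1 2) (edge2 A 0 1 2) (edge3 A 0 1 2)"
proof -
  have "restr_tri 2 A = A" using dist_tri[OF _ assms] by (simp add: is_tri_def)
  then show ?thesis unfolding restr_tri_2[symmetric] by simp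
qed

lemma rotate:
  assumes "tri2 a b c u v w \<in> D 2"
  shows "tri2 b c (sho C a) v w (mneg C (sha C u)) \<in> D 2"
  using rotation[OF _ assms] by (simp add: rot_def restr_tri_2)

lemma transport:
  assumes T: "tri2 a b c u v w \<in> D 2"
    and f: "inverses a a' f f'" and g: "inverses b b' g g'" and h: "inverses c c' h h'"
    and homs: "u' \<in> Hom C a' b'" "v' \<in> Hom C b' c'" "w' \<in> Hom C c' (sho C a')"
    and eqs: "g \<cdot> u = u' \<cdot> f" "h \<cdot> v = v' \<cdot> g" "sha C f \<cdot> w = w' \<cdot> h"
  shows "tri2 a' b' c' u' v' w' \<in> D 2"
proof -
  have "a' \<in> Obj C" "b' \<in> Obj C" "c' \<in> Obj C"
    using homs src_ob[of u'] tgt_ob[of u'] tgt_ob[of v'] by (auto simp: Hom_iff)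
  then have "is_tri C 2 (tri2 a' b' c' u' v' w')"
    using homs by (simp add: is_tri_tri2)
  then show ?thesis
    using iso_tri[OF _ T tri_isosI[OF dist_tri[OF _ T] _ f g h eqs]] by simp
qed

lemma extend_map:
  assumes T: "tri2 a b c u v w \<in> D 2" and T': "tri2 a' b' c' u' v' w' \<in> D 2"
    and f: "f \<in> Hom C a a'" and g: "g \<in> Hom C b b'" and eq: "g \<cdot> u = u' \<cdot> f"
  obtains h where "h \<in> Hom C c c'" "h \<cdot> v = v' \<cdot> g" "w' \<cdot> h = sha C f \<cdot> w"
proof -
  let ?T = "tri2 a b c u v w" and ?T' = "tri2 a' b' c' u' v' w'"
  let ?t = "\<lambda>j::nat. if j = 1 then f else g"
  have "is_simplex_map C 2 (base 2 ?T) (base 2 ?T') ?t"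
    unfolding is_simplex_map_def all_simplex_2
    using is_simplex_base_2[OF dist_tri[OF _ T]] is_simplex_base_2[OF dist_tri[OF _ T']] f g eq
    by simp
  then obtain \<phi> where \<phi>: "\<phi> \<in> M 2 ?T ?T'" and t: "\<forall>j. 1 \<le> j \<and> j \<le> 2 \<longrightarrow> \<phi> 0 j = ?t j"
    using base_map_ex[OF _ T T'] by blast
  have "\<phi> \<in> tri_maps C 2 ?T ?T'" using dist_map[OF _ \<phi>] by simp
  moreover from this have "restr2 2 \<phi> = \<phi>" by (simp add: tri_maps_def)
  ultimately have "tri2_map (\<phi> 0 1) (\<phi> 0 2) (\<phi> 1 2) \<in> tri_maps C 2 ?T ?T'"
    unfolding restr2_2[symmetric] by simp
  moreover have "\<phi> 0 1 = f" "\<phi> 0 2 = g" using t by auto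
  ultimately have "tri2_map f g (\<phi> 1 2) \<in> tri_maps C 2 ?T ?T'" by simp
  then show ?thesis
    using that[of "\<phi> 1 2"] by (simp add: tri2_map_in_tri_maps)
qed

lemma triangle_ex:
  assumes "u \<in> Hom C a b"
  obtains c v w where "tri2 a b c u v w \<in> D 2"
proof -
  let ?S = "restr_simplex 2 \<lparr>svert = (\<lambda>i::nat. if i = 1 then a else b), sedge = (\<lambda>i j. u)\<rparr>"
  have ob: "a \<in> Obj C" "b \<in> Obj C" using assms src_ob[of u] tgt_ob[of u] by (auto simp: Hom_iff)
  have "is_simplex C 2 ?S"
    unfolding is_simplex_def restr_simplex_idem all_simplex_2
    using assms ob by (simp add: restr_simplex_def)
  then obtain A where A: "A \<in> D 2" "base 2 A = ?S"
    using base_ex by blast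
  have "svert (base 2 A) 1 = a" "svert (base 2 A) 2 = b" "sedge (base 2 A) 1 2 = u"
    unfolding A(2) by (simp_all add: restr_simplex_def)
  then have "vert A 0 1 = a" "vert A 0 2 = b" "edge1 A 0 1 2 = u"
    by (simp_all add: base_def restr_simplex_def)
  then show ?thesis
    using that[of "vert A 1 2" "edge2 A 0 1 2" "edge3 A 0 1 2"] dist_eq_tri2[OF A(1)] A(1) by simp
qed

text \<open>Applying the axioms for maps to identities shows that degeneracies and faces preserve distinguished triangles.\<close>

lemma degen_dist:
  assumes "A \<in> D 2" "m \<le> 2"
  shows "degen C 3 m A \<in> D 3"
proof -
  have "tri_ident C 2 A \<in> M (3 - 1) A A" using dist_ident assms by simp
  then have "degen_map C 3 m (tri_ident C 2 A) \<in> M 3 (degen C 3 m A) (degen C 3 m A)"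
    using degeneracies[of 3 m] assms by simp
  then show ?thesis using dist_map[of 3] by auto
qed

lemma face_dist:
  assumes "A \<in> D 3" "m \<le> 3"
  shows "face 3 m A \<in> D 2"
proof -
  have "face_map 3 m (tri_ident C 3 A) \<in> M (3 - 1) (face 3 m A) (face 3 m A)"
    using dist_ident assms by (intro faces) simp_all
  then show ?thesis using dist_map[of 2] by auto
qed

text \<open>These triangles are outer faces of the degenerations of any triangle whose first edge starts
  at \<open>a\<close>: repeating an index produces an identity edge next to a zero object.\<close>

lemma contractible:
  assumes a: "a \<in> Obj C"
  shows "tri2 (zero_ob C) a a (mzero C (zero_ob C) a) (ident C a) (mzero C a (sho C (zero_ob C))) \<in> D 2"
    and "tri2 a a (zero_ob C) (ident C a) (mzero C a (zero_ob C)) (mzero C (zero_ob C) (sho C a)) \<in> D 2"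
proof -
  obtain c v w where T: "tri2 a a c (ident C a) v w \<in> D 2"
    using triangle_ex[OF ident_hom[OF a]] .
  note d = degen_dist[OF T]
  show "tri2 (zero_ob C) a a (mzero C (zero_ob C) a) (ident C a) (mzero C a (sho C (zero_ob C))) \<in> D 2"
    using face_dist[OF d[of 0], of 3]
    by (simp add: face_3 degen_def restr2_def restr3_def degen_vert_def dup_def skip_def)
  show "tri2 a a (zero_ob C) (ident C a) (mzero C a (zero_ob C)) (mzero C (zero_ob C) (sho C a)) \<in> D 2"
    using face_dist[OF d[of 1], of 3]
    by (simp add: face_3 degen_def restr2_def restr3_def degen_vert_def dup_def skip_def)
qed

text \<open>In the 3-triangle obtained by repeating the middle index, one of the squares has \<open>v \<cdot> u\<close> on one
  side and a composite through the zero object on the other.\<close>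

lemma comp_vu_zero:
  assumes T: "tri2 a b c u v w \<in> D 2"
  shows "v \<cdot> u = mzero C a c"
proof -
  have "is_tri C 3 (degen C 3 1 (tri2 a b c u v w))"
    using degen_dist[OF T, of 1] dist_tri[of 3] by simp
  then have "cmp C (edge2 (degen C 3 1 (tri2 a b c u v w)) 0 1 3) (edge1 (degen C 3 1 (tri2 a b c u v w)) 0 2 3)
    = cmp C (edge1 (degen C 3 1 (tri2 a b c u v w)) 1 2 3) (edge2 (degen C 3 1 (tri2 a b c u v w)) 0 1 2)"
    unfolding is_tri_def by simp
  then show ?thesis
    using tri2_facts[OF T] by (simp add: degen_def restr3_def degen_vert_def dup_def)
qed

lemma comp_wv_zero:
  assumes T: "tri2 a b c u v w \<in> D 2"
  shows "w \<cdot> v = mzero C b (sho C a)"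
  using comp_vu_zero[OF rotate[OF T]] .

text \<open>If \<open>f \<cdot> v = 0\<close>, then \<open>(0, f)\<close> is a map on the first two vertices from the rotated triangle to
  the contractible triangle \<open>0 \<rightarrow> x \<rightarrow> x\<close>; its third component is the factorisation.\<close>

lemma weak_cokernel:
  assumes T: "tri2 a b c u v w \<in> D 2" and f: "f \<in> Hom C c x" and 0: "f \<cdot> v = mzero C b x"
  shows "\<exists>\<beta> \<in> Hom C (sho C a) x. f = \<beta> \<cdot> w"
proof -
  note t = tri2_facts[OF T]
  have x: "x \<in> Obj C" using f tgt_ob by (auto simp: Hom_iff)
  obtain \<beta> where "\<beta> \<in> Hom C (sho C a) x" "\<beta> \<cdot> w = ident C x \<cdot> f"
    using extend_map[OF rotate[OF T] contractible(1)[OF x], of "mzero C b (zero_ob C)" f]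
      f x t 0 by (auto simp: Hom_iff)
  then show ?thesis using f x by (auto simp: Hom_iff)
qed

text \<open>Dually, \<open>(y, 0)\<close> is a map from the rotation of \<open>x \<rightarrow> x \<rightarrow> 0\<close> to the rotated triangle, and its
  third component is the shift of the factorisation.\<close>

lemma weak_kernel:
  assumes T: "tri2 a b c u v w \<in> D 2" and y: "y \<in> Hom C x b" and 0: "v \<cdot> y = mzero C x c"
  shows "\<exists>s \<in> Hom C x a. y = u \<cdot> s"
proof -
  note t = tri2_facts[OF T]
  have x: "x \<in> Obj C" using y src_ob by (auto simp: Hom_iff)
  \<comment> \<open>The last edges of both triangles carry a sign, which cancels.\<close>
  obtain h where h: "h \<in> Hom C (sho C x) (sho C a)"
      "mneg C (sha C u) \<cdot> h = sha C y \<cdot> mneg C (sha C (ident C x))"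
    using extend_map[OF rotate[OF contractible(2)[OF x]] rotate[OF T], of y "mzero C (zero_ob C) c"]
      y x t 0 by (auto simp: Hom_iff)
  obtain s where s: "s \<in> Hom C x a" "h = sha C s"
    using sha_full[OF h(1)] x t by auto
  have "mneg C (sha C (u \<cdot> s)) = mneg C (sha C y)"
    using h(2) s y x t by (simp add: Hom_iff)
  then have "u \<cdot> s = y"
    using s y x t by (simp add: Hom_iff del: sha_cmp_arr)
  then show ?thesis using s by auto
qed

lemma third_vertex_unique:
  assumes T: "tri2 a b c u v w \<in> D 2" and T': "tri2 a b c' u v' w' \<in> D 2"
  obtains k k' where "inverses c c' k k'" "k \<cdot> v = v'" "w' \<cdot> k = w"
proof -
  note t = tri2_facts[OF T] and t' = tri2_facts[OF T']
  have i: "ident C a \<in> Hom C a a" "ident C b \<in> Hom C b b" "ident C b \<cdot> u = u \<cdot> ident C a"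
    using t by (simp_all add: Hom_iff)
  obtain k where k: "k \<in> Hom C c c'" "k \<cdot> v = v'" "w' \<cdot> k = w"
    using extend_map[OF T T' i] t t' by auto
  obtain l where l: "l \<in> Hom C c' c" "l \<cdot> v' = v" "w \<cdot> l = w'"
    using extend_map[OF T' T i] t t' by auto
  have h: "v \<in> Hom C b c" "w \<in> Hom C c (sho C a)" "v' \<in> Hom C b c'" "w' \<in> Hom C c' (sho C a)"
    using t t' by (simp_all add: Hom_iff)
  obtain k' where "inverses c c' k k'"
    using comparison_iso[OF k(1) l(1) h k(2,3) l(2,3) weak_cokernel[OF T] weak_cokernel[OF T']] .
  then show ?thesis using that k by blast
qed

text \<open>The rotation with the signs that occur in a mapping cone; the sign of the middle vertex is changed.\<close>

lemma neg_rotate: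
  assumes T: "tri2 a b c u v w \<in> D 2"
  shows "tri2 b c (sho C a) (mneg C v) (mneg C w) (mneg C (sha C u)) \<in> D 2"
proof -
  note t = tri2_facts[OF T]
  have "inverses c c (mneg C (ident C c)) (mneg C (ident C c))"
    using t by (simp add: inverses_def Hom_iff)
  then show ?thesis
    using transport[OF rotate[OF T] inverses_ident _ inverses_ident, of c "mneg C (ident C c)" "mneg C (ident C c)"
      "mneg C v" "mneg C w" "mneg C (sha C u)"]
    by (simp add: t Hom_iff)
qed

text \<open>A triangle with zero connecting map is split by any section \<open>j\<close> of its second map. The
  retraction \<open>r\<close> comes from \<open>p (1 - j p) = 0\<close>. That \<open>r\<close> and \<open>j\<close> satisfy the biproduct equations is first seen
  after composition with \<open>i\<close>. This loses nothing: a map killed by \<open>i\<close> factors, after a shift, through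
  the zero connecting map.\<close>

lemma split_triangle:
  assumes T: "tri2 x z y i p (mzero C y (sho C x)) \<in> D 2" and j: "j \<in> Hom C y z" "p \<cdot> j = ident C y"
  obtains r where "is_biproduct C x y \<lparr>sum_ob = z, in1 = i, in2 = j, pr1 = r, pr2 = p\<rparr>"
proof -
  note t = tri2_facts[OF T] j(1)[unfolded Hom_iff]
  have pi: "p \<cdot> i = mzero C x y" using comp_vu_zero[OF T] .
  have mono: "m = mzero C x' x" if m: "m \<in> Hom C x' x" "i \<cdot> m = mzero C x' z" for m x'
  proof -
    have x': "x' \<in> Obj C" using m src_ob by (auto simp: Hom_iff)
    have "sha C i \<cdot> sha C m = mzero C (sho C x') (sho C z)"
      using m t x' by (simp add: Hom_iff flip: sha_cmp_arr)
    then obtain s where s: "s \<in> Hom C (sho C x') y" "sha C m = mzero C y (sho C x) \<cdot> s"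
      using weak_kernel[OF rotate[OF rotate[OF T]], of "sha C m" "sho C x'"] m t x' by (auto simp: Hom_iff)
    have "sha C m = sha C (mzero C x' x)" using s t x' by (simp add: Hom_iff)
    then show ?thesis using m t x' by (simp add: Hom_iff del: sha_mzero)
  qed
  have "p \<cdot> (ident C z \<boxplus> mneg C (j \<cdot> p)) = mzero C z y"
    using j(2) by (simp add: t cmp_reassoc[OF j(2)])
  then obtain r where r: "r \<in> Hom C z x" "ident C z \<boxplus> mneg C (j \<cdot> p) = i \<cdot> r"
    using weak_kernel[OF T, of "ident C z \<boxplus> mneg C (j \<cdot> p)" z] t by (auto simp: Hom_iff)
  note rh = r(1)[unfolded Hom_iff]
  have sum: "i \<cdot> r \<boxplus> j \<cdot> p = ident C z"
    using t by (simp add: madd_ac flip: r(2))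
  have "i \<cdot> (r \<cdot> i) = i"
    by (simp add: t rh cmp_reassoc[OF r(2)[symmetric]] pi)
  then have "i \<cdot> (r \<cdot> i \<boxplus> mneg C (ident C x)) = mzero C x z"
    by (simp add: t rh)
  then have "r \<cdot> i \<boxplus> mneg C (ident C x) = mzero C x x"
    using mono[of "r \<cdot> i \<boxplus> mneg C (ident C x)" x] by (simp add: t rh Hom_iff)
  then have ri: "r \<cdot> i = ident C x"
    using eq_if_diff_zero[of "r \<cdot> i" "ident C x"] by (simp add: t rh)
  have "i \<cdot> (r \<cdot> j) = mzero C y z"
    by (simp add: t rh cmp_reassoc[OF r(2)[symmetric]] j(2))
  then have rj: "r \<cdot> j = mzero C y x"
    using mono[of "r \<cdot> j" y] by (simp add: t rh Hom_iff)
  show ?thesis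
    using that[of r] by (simp add: is_biproduct_def Hom_iff t rh pi ri rj j(2) sum)
qed

section \<open>Sums of triangles\<close>

text \<open>Complete the sum \<open>U\<close> of the first edges to a distinguished triangle with third vertex \<open>d\<close>. The
  inclusions and projections extend to maps of the two triangles into and out of it, which together
  give maps \<open>k\<close> and \<open>l\<close> between \<open>c \<oplus> c'\<close> and \<open>d\<close> in both directions over the identities of the
  other vertices. The sum inherits the weak cokernel property from its summands, so \<open>k\<close> is an isomorphism
  by \<open>comparison_iso\<close>. The three edges are described through the inclusions, so that the
  lemma applies to any choice of biproducts.\<close>

lemma sum_of_triangles:
  assumes T: "tri2 a b c u v w \<in> D 2" and T': "tri2 a' b' c' u' v' w' \<in> D 2"
    and P: "is_biproduct C a a' P" and Q: "is_biproduct C b b' Q" and R: "is_biproduct C c c' R"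
    and U: "U \<in> Hom C (sum_ob P) (sum_ob Q)" "U \<cdot> in1 P = in1 Q \<cdot> u" "U \<cdot> in2 P = in2 Q \<cdot> u'"
    and V: "V \<in> Hom C (sum_ob Q) (sum_ob R)" "V \<cdot> in1 Q = in1 R \<cdot> v" "V \<cdot> in2 Q = in2 R \<cdot> v'"
    and W: "W \<in> Hom C (sum_ob R) (sho C (sum_ob P))"
      "W \<cdot> in1 R = sha C (in1 P) \<cdot> w" "W \<cdot> in2 R = sha C (in2 P) \<cdot> w'"
  shows "tri2 (sum_ob P) (sum_ob Q) (sum_ob R) U V W \<in> D 2"
proof -
  note t = tri2_facts[OF T] tri2_facts[OF T']
  note p = biprod_facts[OF P] and q = biprod_facts[OF Q] and r = biprod_facts[OF R]
    and sp = biprod_facts[OF is_biproduct_shift[OF P], simplified]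
  have prU: "pr1 Q \<cdot> U = u \<cdot> pr1 P" "pr2 Q \<cdot> U = u' \<cdot> pr2 P"
    using diagonal_pr[OF P Q _ _ U] t by (simp_all add: Hom_iff)
  have prV: "pr1 R \<cdot> V = v \<cdot> pr1 Q" "pr2 R \<cdot> V = v' \<cdot> pr2 Q"
    using diagonal_pr[OF Q R _ _ V] t by (simp_all add: Hom_iff)
  have prW: "sha C (pr1 P) \<cdot> W = w \<cdot> pr1 R" "sha C (pr2 P) \<cdot> W = w' \<cdot> pr2 R"
    using diagonal_pr[OF R is_biproduct_shift[OF P], of w w' W] t W by (simp_all add: Hom_iff)
  obtain d y z where D: "tri2 (sum_ob P) (sum_ob Q) d U y z \<in> D 2"
    using triangle_ex[OF U(1)] .
  note d = tri2_facts[OF D]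
  obtain k1 where k1: "k1 \<in> Hom C c d" "k1 \<cdot> v = y \<cdot> in1 Q" "z \<cdot> k1 = sha C (in1 P) \<cdot> w"
    using extend_map[OF T D, of "in1 P" "in1 Q"] p q U by (auto simp: Hom_iff)
  obtain k2 where k2: "k2 \<in> Hom C c' d" "k2 \<cdot> v' = y \<cdot> in2 Q" "z \<cdot> k2 = sha C (in2 P) \<cdot> w'"
    using extend_map[OF T' D, of "in2 P" "in2 Q"] p q U by (auto simp: Hom_iff)
  obtain l1 where l1: "l1 \<in> Hom C d c" "l1 \<cdot> y = v \<cdot> pr1 Q" "w \<cdot> l1 = sha C (pr1 P) \<cdot> z"
    using extend_map[OF D T, of "pr1 P" "pr1 Q"] p q prU by (auto simp: Hom_iff)
  obtain l2 where l2: "l2 \<in> Hom C d c'" "l2 \<cdot> y = v' \<cdot> pr2 Q" "w' \<cdot> l2 = sha C (pr2 P) \<cdot> z"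
    using extend_map[OF D T', of "pr2 P" "pr2 Q"] p q prU by (auto simp: Hom_iff)
  define k where "k = k1 \<cdot> pr1 R \<boxplus> k2 \<cdot> pr2 R"
  define l where "l = in1 R \<cdot> l1 \<boxplus> in2 R \<cdot> l2"
  have k: "k \<in> Hom C (sum_ob R) d" "k \<cdot> in1 R = k1" "k \<cdot> in2 R = k2"
    using k1 k2 r by (simp_all add: k_def Hom_iff)
  have l: "l \<in> Hom C d (sum_ob R)" "pr1 R \<cdot> l = l1" "pr2 R \<cdot> l = l2"
    using l1 l2 r by (simp_all add: l_def Hom_iff)
  note homs = t p q r d k(1)[unfolded Hom_iff] k1(1)[unfolded Hom_iff] k2(1)[unfolded Hom_iff]
    l(1)[unfolded Hom_iff] l1(1)[unfolded Hom_iff] l2(1)[unfolded Hom_iff]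
    U(1)[unfolded Hom_iff] V(1)[unfolded Hom_iff] W(1)[unfolded Hom_iff]
  have kV: "k \<cdot> V = y"
    by (rule biprod_eqI_dom[OF Q])
      (simp_all add: homs V(2,3) cmp_reassoc[OF k(2)] cmp_reassoc[OF k(3)] k1 k2)
  have zk: "z \<cdot> k = W"
    by (rule biprod_eqI_dom[OF R]) (simp_all add: homs k k1 k2 W)
  have ly: "l \<cdot> y = V"
    by (rule biprod_eqI_cod[OF R])
      (simp_all add: homs prV cmp_reassoc[OF l(2)] cmp_reassoc[OF l(3)] l1 l2)
  have Wl: "W \<cdot> l = z"
    by (rule biprod_eqI_cod[OF is_biproduct_shift[OF P]])
      (simp_all add: homs cmp_reassoc[OF prW(1)] cmp_reassoc[OF prW(2)] l l1 l2)
  have wc: "\<exists>\<beta> \<in> Hom C (sho C (sum_ob P)) (sum_ob R). f = \<beta> \<cdot> W"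
    if f: "f \<in> Hom C (sum_ob R) (sum_ob R)" "f \<cdot> V = mzero C (sum_ob Q) (sum_ob R)" for f
  proof -
    have "(f \<cdot> in1 R) \<cdot> v = (f \<cdot> V) \<cdot> in1 Q" "(f \<cdot> in2 R) \<cdot> v' = (f \<cdot> V) \<cdot> in2 Q"
      using f(1) by (simp_all add: homs V(2,3) Hom_iff)
    then have 0: "(f \<cdot> in1 R) \<cdot> v = mzero C b (sum_ob R)" "(f \<cdot> in2 R) \<cdot> v' = mzero C b' (sum_ob R)"
      unfolding f(2) by (simp_all add: homs)
    obtain \<beta>1 where \<beta>1: "\<beta>1 \<in> Hom C (sho C a) (sum_ob R)" "f \<cdot> in1 R = \<beta>1 \<cdot> w"
      using weak_cokernel[OF T _ 0(1)] f(1) r by (auto simp: Hom_iff)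
    obtain \<beta>2 where \<beta>2: "\<beta>2 \<in> Hom C (sho C a') (sum_ob R)" "f \<cdot> in2 R = \<beta>2 \<cdot> w'"
      using weak_cokernel[OF T' _ 0(2)] f(1) r by (auto simp: Hom_iff)
    let ?\<beta> = "\<beta>1 \<cdot> sha C (pr1 P) \<boxplus> \<beta>2 \<cdot> sha C (pr2 P)"
    have "?\<beta> \<in> Hom C (sho C (sum_ob P)) (sum_ob R)"
      using \<beta>1 \<beta>2 p by (simp add: Hom_iff)
    moreover have "f = ?\<beta> \<cdot> W"
      by (rule biprod_eqI_dom[OF R])
        (use \<beta>1(1) \<beta>2(1) f(1) in \<open>simp_all add: homs Hom_iff W(2,3) \<beta>1(2) \<beta>2(2) sp\<close>)
    ultimately show ?thesis by blast
  qed
  have h: "y \<in> Hom C (sum_ob Q) d" "z \<in> Hom C d (sho C (sum_ob P))"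
    using d by (simp_all add: Hom_iff)
  obtain k' where k': "inverses (sum_ob R) d k k'"
    using comparison_iso[OF k(1) l(1) V(1) W(1) h kV zk ly Wl wc weak_cokernel[OF D]] .
  have "k' \<cdot> (k \<cdot> V) = V" "(W \<cdot> k') = z \<cdot> (k \<cdot> k')"
    using k' by (simp_all add: homs inverses_def Hom_iff cmp_reassoc[of k' k] flip: zk)
  then have "k' \<cdot> y = V" "W \<cdot> k' = z"
    using k' kV d by (simp_all add: inverses_def)
  then show ?thesis
    using transport[OF D inverses_ident inverses_ident inverses_sym[OF k'] U(1) V(1) W(1)]
    by (simp add: homs)
qed

section \<open>Maps that vanish on the first two vertices\<close>

text \<open>The endomorphism of the sum of both triangles with third component \<open>1 + in2 \<cdot> e \<cdot> pr1\<close> and identities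
  elsewhere is an isomorphism, hence distinguished. The lightning axiom, applied to it and to the identity,
  writes \<open>in2 \<cdot> e \<cdot> pr1\<close> as \<open>V \<Theta> W\<close>, and the entry of \<open>\<Theta>\<close> from \<open>a[1]\<close> to \<open>b'\<close> is the desired \<open>\<theta>\<close>.\<close>

lemma lightning_strike:
  assumes T: "tri2 a b c u v w \<in> D 2" and T': "tri2 a' b' c' u' v' w' \<in> D 2"
    and e: "e \<in> Hom C c c'" "e \<cdot> v = mzero C b c'" "w' \<cdot> e = mzero C c (sho C a')"
  obtains \<theta> where "\<theta> \<in> Hom C (sho C a) b'" "e = v' \<cdot> (\<theta> \<cdot> w)"
proof -
  note t = tri2_facts[OF T] tri2_facts[OF T']
  obtain P where P: "is_biproduct C a a' P" using biproducts[OF t(1) t(13)] ..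
  obtain Q where Q: "is_biproduct C b b' Q" using biproducts[OF t(2) t(14)] ..
  obtain R where R: "is_biproduct C c c' R" using biproducts[OF t(3) t(15)] ..
  note p = biprod_facts[OF P] and q = biprod_facts[OF Q] and r = biprod_facts[OF R]
    and sp = is_biproduct_shift[OF P]
  define U where "U = mat2 C P Q u (mzero C a' b) (mzero C a b') u'"
  define V where "V = mat2 C Q R v (mzero C b' c) (mzero C b c') v'"
  define W where "W = mat2 C R (shift_biprod C P) w (mzero C c' (sho C a)) (mzero C c (sho C a')) w'"
  have U: "U \<in> Hom C (sum_ob P) (sum_ob Q)" "U \<cdot> in1 P = in1 Q \<cdot> u" "U \<cdot> in2 P = in2 Q \<cdot> u'"
    using t q by (simp_all add: U_def mat2_facts[OF P Q] Hom_iff)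
  have V: "V \<in> Hom C (sum_ob Q) (sum_ob R)" "V \<cdot> in1 Q = in1 R \<cdot> v" "V \<cdot> in2 Q = in2 R \<cdot> v'"
    using t r by (simp_all add: V_def mat2_facts[OF Q R] Hom_iff)
  have W: "W \<in> Hom C (sum_ob R) (sho C (sum_ob P))"
      "W \<cdot> in1 R = sha C (in1 P) \<cdot> w" "W \<cdot> in2 R = sha C (in2 P) \<cdot> w'"
    using t p by (simp_all add: W_def mat2_facts[OF R sp] Hom_iff)
  let ?S = "tri2 (sum_ob P) (sum_ob Q) (sum_ob R) U V W"
  have S: "?S \<in> D 2"
    using sum_of_triangles[OF T T' P Q R U V W] .
  have prV: "pr1 R \<cdot> V = v \<cdot> pr1 Q" "pr2 R \<cdot> V = v' \<cdot> pr2 Q"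
    using diagonal_pr[OF Q R _ _ V] t by (simp_all add: Hom_iff)
  define E where "E = in2 R \<cdot> (e \<cdot> pr1 R)"
  have E: "E \<in> Hom C (sum_ob R) (sum_ob R)" "E \<cdot> E = mzero C (sum_ob R) (sum_ob R)"
    using e(1) r t by (simp_all add: E_def Hom_iff)
  have EV: "E \<cdot> V = mzero C (sum_ob Q) (sum_ob R)"
    using e(1) V(1) by (simp add: E_def Hom_iff t q r prV cmp_reassoc[OF e(2)])
  have WE: "W \<cdot> E = mzero C (sum_ob R) (sho C (sum_ob P))"
    using e(1) W(1) by (simp add: E_def Hom_iff t p r cmp_reassoc[OF W(3)] cmp_reassoc[OF e(3)])
  let ?I = "ident C (sum_ob R)"
  have i: "inverses (sum_ob R) (sum_ob R) (?I \<boxplus> E) (?I \<boxplus> mneg C E)"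
    using E r by (simp add: inverses_def Hom_iff madd_ac)
  have iso: "tri2_map (ident C (sum_ob P)) (ident C (sum_ob Q)) h \<in> M 2 ?S ?S"
    if "inverses (sum_ob R) (sum_ob R) h h'" "h \<cdot> V = V" "W \<cdot> h = W" for h h'
    using that U V W p q
      iso_map[OF _ S S tri_isosI[OF dist_tri[OF _ S] dist_tri[OF _ S] inverses_ident inverses_ident that(1)]]
    by (simp add: Hom_iff)
  have "tri2_map (ident C (sum_ob P)) (ident C (sum_ob Q)) ?I \<in> M 2 ?S ?S"
    using V W r by (intro iso[OF inverses_ident]) (auto simp: Hom_iff)
  moreover have "tri2_map (ident C (sum_ob P)) (ident C (sum_ob Q)) (?I \<boxplus> E) \<in> M 2 ?S ?S"
    using V W r E EV WE by (intro iso[OF i]) (auto simp: Hom_iff)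
  ultimately obtain \<Theta> where \<Theta>: "\<Theta> \<in> Hom C (sho C (sum_ob P)) (sum_ob Q)"
      "mdiff C (?I \<boxplus> E) ?I = V \<cdot> \<Theta> \<cdot> W"
    using lightning by blast
  then have "E = V \<cdot> (\<Theta> \<cdot> W)"
    using E r V W by (simp add: mdiff_def Hom_iff madd_ac)
  then have "pr2 R \<cdot> (E \<cdot> in1 R) = pr2 R \<cdot> (V \<cdot> (\<Theta> \<cdot> (W \<cdot> in1 R)))"
    using V W \<Theta> r by (simp add: Hom_iff)
  also have "\<dots> = (pr2 R \<cdot> V) \<cdot> (\<Theta> \<cdot> (sha C (in1 P) \<cdot> w))"
    unfolding W(2) using V W \<Theta> r p t by (simp add: Hom_iff)
  also have "\<dots> = v' \<cdot> ((pr2 Q \<cdot> \<Theta> \<cdot> sha C (in1 P)) \<cdot> w)"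
    unfolding prV(2) using \<Theta> r p t q by (simp add: Hom_iff)
  also have "pr2 R \<cdot> (E \<cdot> in1 R) = e"
    using e(1) r by (simp add: E_def Hom_iff)
  finally show ?thesis
    using \<Theta>(1) p q by (intro that[of "pr2 Q \<cdot> \<Theta> \<cdot> sha C (in1 P)"]) (simp_all add: Hom_iff)
qed

section \<open>The octahedron\<close>

text \<open>The four faces of a distinguished 3-triangle with base \<open>x1 \<rightarrow> x2 \<rightarrow> x3\<close> are the four triangles of the
  octahedron, and its remaining edge equations are the commutativities. As the third vertex of a triangle is unique up to
  isomorphism, two of the faces can be replaced by the given triangles.\<close>

lemma octahedron:
  assumes T: "tri2 x1 x2 y s s1 s2 \<in> D 2" and T': "tri2 x2 x3 y' t t1 t2 \<in> D 2"
  obtains z q k i p where "tri2 x1 x3 z (t \<cdot> s) q k \<in> D 2" "tri2 y z y' i p (sha C s1 \<cdot> t2) \<in> D 2"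
    "i \<cdot> s1 = q \<cdot> t" "k \<cdot> i = s2" "p \<cdot> q = t1" "t2 \<cdot> p = sha C s \<cdot> k"
proof -
  note tt = tri2_facts[OF T] tri2_facts[OF T']
  let ?S = "restr_simplex 3 \<lparr>svert = (\<lambda>i::nat. if i = 1 then x1 else if i = 2 then x2 else x3),
    sedge = (\<lambda>i j. if j = 2 then s else if i = 2 then t else t \<cdot> s)\<rparr>"
  have "is_simplex C 3 ?S"
    unfolding is_simplex_def restr_simplex_idem
    using tt by (auto simp: restr_simplex_def Hom_iff)
  then obtain A where A: "A \<in> D 3" "base 3 A = ?S"
    using base_ex[of 3] by auto
  have "svert (base 3 A) 1 = x1" "svert (base 3 A) 2 = x2" "svert (base 3 A) 3 = x3"
    "sedge (base 3 A) 1 2 = s" "sedge (base 3 A) 2 3 = t" "sedge (base 3 A) 1 3 = t \<cdot> s"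
    unfolding A(2) by (simp_all add: restr_simplex_def)
  then have b: "vert A 0 (Suc 0) = x1" "vert A 0 2 = x2" "vert A 0 3 = x3"
    "edge1 A 0 (Suc 0) 2 = s" "edge1 A 0 2 3 = t" "edge1 A 0 (Suc 0) 3 = t \<cdot> s"
    by (simp_all add: base_def restr_simplex_def)
  have F0: "tri2 (vert A (Suc 0) 2) (vert A (Suc 0) 3) (vert A 2 3) (edge1 A (Suc 0) 2 3) (edge2 A (Suc 0) 2 3) (edge3 A (Suc 0) 2 3) \<in> D 2"
    using face_dist[OF A(1), of 0]
    unfolding face_3 skip_def by (simp add: numeral_2_eq_2 numeral_3_eq_3)
  have F1: "tri2 x2 x3 (vert A 2 3) t (edge2 A 0 2 3) (edge3 A 0 2 3) \<in> D 2"
    using face_dist[OF A(1), of 1] b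
    unfolding face_3 skip_def by (simp add: numeral_2_eq_2 numeral_3_eq_3)
  have F2: "tri2 x1 x3 (vert A (Suc 0) 3) (t \<cdot> s) (edge2 A 0 (Suc 0) 3) (edge3 A 0 (Suc 0) 3) \<in> D 2"
    using face_dist[OF A(1), of 2] b
    unfolding face_3 skip_def by (simp add: numeral_2_eq_2 numeral_3_eq_3)
  have F3: "tri2 x1 x2 (vert A (Suc 0) 2) s (edge2 A 0 (Suc 0) 2) (edge3 A 0 (Suc 0) 2) \<in> D 2"
    using face_dist[OF A(1), of 3] b by (simp add: face_3 skip_def)
  note f = tri2_facts[OF F0] tri2_facts[OF F1] tri2_facts[OF F2] tri2_facts[OF F3]
  have tri: "is_tri C 3 A" using dist_tri[OF _ A(1)] by simp
  have r1: "edge2 A 0 (Suc 0) 3 \<cdot> t = edge1 A (Suc 0) 2 3 \<cdot> edge2 A 0 (Suc 0) 2"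
    and r2: "edge3 A 0 2 3 \<cdot> edge2 A (Suc 0) 2 3 = sha C s \<cdot> edge3 A 0 (Suc 0) 3"
    and r3: "edge3 A 0 (Suc 0) 2 = edge3 A 0 (Suc 0) 3 \<cdot> edge1 A (Suc 0) 2 3"
    and r4: "sha C (edge2 A 0 2 3) = sha C (edge2 A (Suc 0) 2 3) \<cdot> sha C (edge2 A 0 (Suc 0) 3)"
    and r5: "edge3 A (Suc 0) 2 3 = sha C (edge2 A 0 (Suc 0) 2) \<cdot> edge3 A 0 2 3"
    using tri b unfolding is_tri_def by auto
  have r4': "edge2 A 0 2 3 = edge2 A (Suc 0) 2 3 \<cdot> edge2 A 0 (Suc 0) 3"
    using r4 f by (simp flip: sha_cmp_arr)
  obtain \<alpha> \<alpha>' where \<alpha>: "inverses y (vert A (Suc 0) 2) \<alpha> \<alpha>'" "\<alpha> \<cdot> s1 = edge2 A 0 (Suc 0) 2" "edge3 A 0 (Suc 0) 2 \<cdot> \<alpha> = s2"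
    using third_vertex_unique[OF T F3] .
  obtain \<beta> \<beta>' where \<beta>: "inverses y' (vert A 2 3) \<beta> \<beta>'" "\<beta> \<cdot> t1 = edge2 A 0 2 3" "edge3 A 0 2 3 \<cdot> \<beta> = t2"
    using third_vertex_unique[OF T' F1] .
  note \<alpha>h = \<alpha>(1)[unfolded inverses_def Hom_iff] and \<beta>h = \<beta>(1)[unfolded inverses_def Hom_iff]
  have \<alpha>': "\<alpha>' \<cdot> edge2 A 0 (Suc 0) 2 = s1"
    unfolding \<alpha>(2)[symmetric] by (simp add: tt f \<alpha>h cmp_reassoc[of \<alpha>' \<alpha>])
  have \<beta>': "\<beta>' \<cdot> edge2 A 0 2 3 = t1" "t2 \<cdot> \<beta>' = edge3 A 0 2 3"
    unfolding \<beta>(2,3)[symmetric] by (simp_all add: tt f \<beta>h cmp_reassoc[of \<beta>' \<beta>])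
  show ?thesis
  proof (rule that[OF F2])
    have "sha C \<alpha>' \<cdot> sha C (edge2 A 0 (Suc 0) 2) = sha C s1"
      unfolding \<alpha>'[symmetric] using \<alpha>h f by simp
    then have "sha C \<alpha>' \<cdot> edge3 A (Suc 0) 2 3 = sha C s1 \<cdot> edge3 A 0 2 3"
      unfolding r5 using \<alpha>h f tt by (simp add: cmp_reassoc)
    then show "tri2 y (vert A (Suc 0) 3) y' (edge1 A (Suc 0) 2 3 \<cdot> \<alpha>) (\<beta>' \<cdot> edge2 A (Suc 0) 2 3) (sha C s1 \<cdot> t2) \<in> D 2"
      using transport[OF F0 inverses_sym[OF \<alpha>(1)] inverses_ident inverses_sym[OF \<beta>(1)],
          of "edge1 A (Suc 0) 2 3 \<cdot> \<alpha>" "\<beta>' \<cdot> edge2 A (Suc 0) 2 3" "sha C s1 \<cdot> t2"]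
      by (simp add: Hom_iff f tt \<alpha>h \<beta>h \<beta>')
    show "(edge1 A (Suc 0) 2 3 \<cdot> \<alpha>) \<cdot> s1 = edge2 A 0 (Suc 0) 3 \<cdot> t"
      using r1 by (simp add: f tt \<alpha>h \<alpha>(2))
    show "edge3 A 0 (Suc 0) 3 \<cdot> (edge1 A (Suc 0) 2 3 \<cdot> \<alpha>) = s2"
      using \<alpha>(3) by (simp add: r3 f tt \<alpha>h)
    show "(\<beta>' \<cdot> edge2 A (Suc 0) 2 3) \<cdot> edge2 A 0 (Suc 0) 3 = t1"
      using \<beta>'(1) by (simp add: r4' f tt \<beta>h)
    show "t2 \<cdot> (\<beta>' \<cdot> edge2 A (Suc 0) 2 3) = sha C s \<cdot> edge3 A 0 (Suc 0) 3"
      using r2 by (simp add: cmp_reassoc[OF \<beta>'(2)] f tt \<beta>h)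
  qed
qed

section \<open>Mapping cones\<close>

text \<open>This is the octahedral construction of a good third component; \<open>s\<close> and \<open>n\<close> are the two factors of
  the first map of the cone, and \<open>X = b' \<oplus> b\<close>.\<close>

lemma cone_exists:
  assumes T: "tri2 a b c u v w \<in> D 2" and T': "tri2 a' b' c' u' v' w' \<in> D 2"
    and f: "f \<in> Hom C a a'" and g: "g \<in> Hom C b b'" and gu: "g \<cdot> u = u' \<cdot> f"
    and P: "is_biproduct C a' b P" and Q: "is_biproduct C b' c Q" and R: "is_biproduct C c' (sho C a) R"
  obtains h where "h \<in> Hom C c c'" "h \<cdot> v = v' \<cdot> g" "w' \<cdot> h = sha C f \<cdot> w"
    "mapping_cone C P Q R a b c u v w a' b' c' u' v' w' f g h \<in> D 2"
proof -
  note t = tri2_facts[OF T] tri2_facts[OF T'] f[unfolded Hom_iff] g[unfolded Hom_iff]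
  obtain X where X: "is_biproduct C b' b X" using biproducts[OF t(14) t(2)] ..
  note p = biprod_facts[OF P] and q = biprod_facts[OF Q] and r = biprod_facts[OF R] and x = biprod_facts[OF X]
    and sP = is_biproduct_shift[OF P] and sX = is_biproduct_shift[OF X]
  note sp = biprod_facts[OF sP, simplified] and sx = biprod_facts[OF sX, simplified]
  have vu': "v' \<cdot> u' = mzero C a' c'" using comp_vu_zero[OF T'] .
  define s where "s = mat2 C P X u' g (mzero C a' b) (ident C b)"
  define n where "n = mat2 C X Q (ident C b') (mzero C b b') (mzero C b' c) (mneg C v)"
  define s1 where "s1 = v' \<cdot> pr1 X \<boxplus> mneg C (v' \<cdot> (g \<cdot> pr2 X))"
  define s2 where "s2 = sha C (in1 P) \<cdot> w'"
  define n1 where "n1 = mneg C w \<cdot> pr2 Q"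
  define n2 where "n2 = sha C (in2 X) \<cdot> mneg C (sha C u)"
  have s: "s \<in> Arr C" "src C s = sum_ob P" "tgt C s = sum_ob X" "s \<cdot> in1 P = in1 X \<cdot> u'"
    "s \<cdot> in2 P = in1 X \<cdot> g \<boxplus> in2 X" "pr1 X \<cdot> s = u' \<cdot> pr1 P \<boxplus> g \<cdot> pr2 P" "pr2 X \<cdot> s = pr2 P"
    by (simp_all add: s_def mat2_facts[OF P X] Hom_iff t p x)
  have n: "n \<in> Arr C" "src C n = sum_ob X" "tgt C n = sum_ob Q" "n \<cdot> in1 X = in1 Q"
    "n \<cdot> in2 X = mneg C (in2 Q \<cdot> v)"
    by (simp_all add: n_def mat2_facts[OF X Q] Hom_iff t x q)
  \<comment> \<open>In the sheared coordinates of \<open>X\<close>, the map \<open>s\<close> is the sum of \<open>u'\<close> and the identity of \<open>b\<close>.\<close>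
  have S: "tri2 (sum_ob P) (sum_ob X) c' s s1 s2 \<in> D 2"
    using sum_of_triangles[OF T' contractible(2)[OF t(2)] P is_biproduct_shear[OF X g] is_biproduct_zero(1)[OF t(15)],
        of s s1 s2]
    by (simp add: Hom_iff s s1_def s2_def t p x)
  \<comment> \<open>The sum of \<open>b' = b'\<close> with the negated rotation of \<open>(u, v, w)\<close>.\<close>
  have N: "tri2 (sum_ob X) (sum_ob Q) (sho C a) n n1 n2 \<in> D 2"
    using sum_of_triangles[OF contractible(2)[OF t(14)] neg_rotate[OF T] X Q is_biproduct_zero(2)[OF sho_obj[OF t(1)]],
        of n n1 n2]
    by (simp add: Hom_iff n n1_def n2_def t q x)
  note sn = tri2_facts[OF S] tri2_facts[OF N]
  \<comment> \<open>Here the square commutes in an essential way: up to sign this is \<open>v' g u = v' u' f = 0\<close>.\<close>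
  have "s1 \<cdot> (in2 X \<cdot> u) = mzero C a c'"
    by (simp add: s1_def t x gu cmp_reassoc[OF vu'])
  from arg_cong[OF this, of "sha C"] have "sha C s1 \<cdot> n2 = mzero C (sho C a) (sho C c')"
    by (simp add: n2_def sn t x)
  moreover obtain z y k i e where Z: "tri2 (sum_ob P) (sum_ob Q) z (n \<cdot> s) y k \<in> D 2"
    and E: "tri2 c' z (sho C a) i e (sha C s1 \<cdot> n2) \<in> D 2"
    and oct: "i \<cdot> s1 = y \<cdot> n" "k \<cdot> i = s2" "e \<cdot> y = n1" "n2 \<cdot> e = sha C s \<cdot> k"
    using octahedron[OF S N] .
  ultimately have E: "tri2 c' z (sho C a) i e (mzero C (sho C a) (sho C c')) \<in> D 2"
    by simp
  note ze = tri2_facts[OF Z] tri2_facts[OF E]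
  have ei: "e \<cdot> i = mzero C c' (sho C a)" using comp_vu_zero[OF E] .
  \<comment> \<open>The identity of \<open>a[1]\<close> is killed by the zero connecting map, so it lifts along \<open>e\<close>.\<close>
  obtain j0 where j0: "j0 \<in> Hom C (sho C a) z" "ident C (sho C a) = e \<cdot> j0"
    using weak_kernel[OF rotate[OF E], of "ident C (sho C a)" "sho C a"] t by (auto simp: Hom_iff)
  note j0h = j0(1)[unfolded Hom_iff]
  \<comment> \<open>For any section, the component \<open>x2\<close> of \<open>k \<cdot> j0\<close> is forced to be \<open>-u[1]\<close>, while \<open>x1\<close> agrees with \<open>f[1]\<close> only up to a map killed by \<open>u'[1]\<close>.\<close>
  have sk: "sha C s \<cdot> (k \<cdot> j0) = n2"
    using cmp_reassoc[OF oct(4), of j0] by (simp add: ze sn j0h flip: j0(2))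
  define x1 where "x1 = sha C (pr1 P) \<cdot> (k \<cdot> j0)"
  define x2 where "x2 = sha C (pr2 P) \<cdot> (k \<cdot> j0)"
  have xh: "x1 \<in> Arr C" "src C x1 = sho C a" "tgt C x1 = sho C a'"
    "x2 \<in> Arr C" "src C x2 = sho C a" "tgt C x2 = sho C b"
    by (simp_all add: x1_def x2_def ze j0h p t)
  have pr1s: "sha C (pr1 X) \<cdot> sha C s = sha C u' \<cdot> sha C (pr1 P) \<boxplus> sha C g \<cdot> sha C (pr2 P)"
    using arg_cong[OF s(6), of "sha C"] by (simp add: s(1-3) x p t)
  have pr2s: "sha C (pr2 X) \<cdot> sha C s = sha C (pr2 P)"
    using arg_cong[OF s(7), of "sha C"] by (simp add: s(1-3) x p t)
  have x2: "x2 = mneg C (sha C u)"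
    using arg_cong[OF sk, of "\<lambda>m. sha C (pr2 X) \<cdot> m"] cmp_reassoc[OF pr2s, of "k \<cdot> j0"]
    by (simp add: x2_def n2_def ze j0h s(1-3) x p t sx)
  have "sha C u' \<cdot> x1 \<boxplus> sha C g \<cdot> x2 = mzero C (sho C a) (sho C b')"
    using arg_cong[OF sk, of "\<lambda>m. sha C (pr1 X) \<cdot> m"] cmp_reassoc[OF pr1s, of "k \<cdot> j0"]
    by (simp add: x1_def x2_def n2_def ze j0h s(1-3) x p t sx)
  then have "sha C u' \<cdot> x1 = sha C g \<cdot> sha C u"
    using eq_if_diff_zero[of "sha C u' \<cdot> x1" "sha C g \<cdot> sha C u"]
    by (simp add: x2 xh t)
  also have "\<dots> = sha C u' \<cdot> sha C f"
    using arg_cong[OF gu, of "sha C"] by (simp add: t)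
  finally have "sha C u' \<cdot> x1 = sha C u' \<cdot> sha C f" .
  then have "mneg C (sha C u') \<cdot> (x1 \<boxplus> mneg C (sha C f)) = mzero C (sho C a) (sho C b')"
    by (simp add: xh t)
  then obtain m where m: "m \<in> Hom C (sho C a) c'" "x1 \<boxplus> mneg C (sha C f) = w' \<cdot> m"
    using weak_kernel[OF rotate[OF rotate[OF T']], of "x1 \<boxplus> mneg C (sha C f)" "sho C a"]
    by (auto simp: xh t Hom_iff)
  note mh = m(1)[unfolded Hom_iff]
  \<comment> \<open>The difference factors through \<open>w'\<close>, which is what \<open>k\<close> is on \<open>c'\<close>; so it can be absorbed into the section.\<close>
  define j where "j = j0 \<boxplus> mneg C (i \<cdot> m)"
  have j: "j \<in> Hom C (sho C a) z" "e \<cdot> j = ident C (sho C a)"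
    using j0(2) by (simp_all add: j_def Hom_iff j0h mh ze cmp_reassoc[OF ei] t)
  note jh = j(1)[unfolded Hom_iff]
  have "sha C (pr1 P) \<cdot> (k \<cdot> j) = x1 \<boxplus> mneg C (w' \<cdot> m)"
    by (simp add: j_def x1_def j0h mh ze cmp_reassoc[OF oct(2)] s2_def p sp t)
  also have "\<dots> = sha C f"
    by (simp add: xh t madd_ac flip: m(2))
  finally have k1: "sha C (pr1 P) \<cdot> (k \<cdot> j) = sha C f" .
  have k2: "sha C (pr2 P) \<cdot> (k \<cdot> j) = mneg C (sha C u)"
    unfolding x2[symmetric]
    by (simp add: j_def x2_def j0h mh ze cmp_reassoc[OF oct(2)] s2_def p sp t)
  have kj: "k \<cdot> j = sha C (in1 P) \<cdot> sha C f \<boxplus> sha C (in2 P) \<cdot> mneg C (sha C u)"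
    by (rule biprod_eqI_cod[OF sP]) (simp_all add: k1 k2 ze jh p sp t)
  obtain l where B: "is_biproduct C c' (sho C a) \<lparr>sum_ob = z, in1 = i, in2 = j, pr1 = l, pr2 = e\<rparr>"
    using split_triangle[OF E j] .
  note b = biprod_facts[OF B, simplified]
  define \<kappa> where "\<kappa> = in1 R \<cdot> l \<boxplus> in2 R \<cdot> e"
  have \<kappa>: "inverses z (sum_ob R) \<kappa> (i \<cdot> pr1 R \<boxplus> j \<cdot> pr2 R)"
    using biprod_inverses[OF B R] by (simp add: \<kappa>_def)
  have \<kappa>h: "\<kappa> \<in> Arr C" "src C \<kappa> = z" "tgt C \<kappa> = sum_ob R" "\<kappa> \<cdot> i = in1 R" "\<kappa> \<cdot> j = in2 R"
    "pr1 R \<cdot> \<kappa> = l" "pr2 R \<cdot> \<kappa> = e"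
    by (simp_all add: \<kappa>_def b r)
  define h where "h = l \<cdot> (y \<cdot> in2 Q)"
  have h: "h \<in> Hom C c c'" by (simp add: h_def Hom_iff b ze q)
  note hh = h[unfolded Hom_iff]
  let ?U = "mat2 C P Q u' g (mzero C a' c) (mneg C v)"
  let ?V = "mat2 C Q R v' h (mzero C b' (sho C a)) (mneg C w)"
  let ?W = "mat2 C R (shift_biprod C P) w' (sha C f) (mzero C c' (sho C b)) (mneg C (sha C u))"
  have U: "?U \<in> Arr C" "src C ?U = sum_ob P" "tgt C ?U = sum_ob Q"
    "?U \<cdot> in1 P = in1 Q \<cdot> u'" "?U \<cdot> in2 P = in1 Q \<cdot> g \<boxplus> mneg C (in2 Q \<cdot> v)"
    by (simp_all add: mat2_facts[OF P Q] Hom_iff t p q)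
  have V: "?V \<in> Arr C" "src C ?V = sum_ob Q" "tgt C ?V = sum_ob R"
    "?V \<cdot> in1 Q = in1 R \<cdot> v'" "?V \<cdot> in2 Q = in1 R \<cdot> h \<boxplus> mneg C (in2 R \<cdot> w)"
    by (simp_all add: mat2_facts[OF Q R] Hom_iff t q r hh)
  have W: "?W \<in> Arr C" "src C ?W = sum_ob R" "tgt C ?W = sho C (sum_ob P)"
    "?W \<cdot> in1 R = sha C (in1 P) \<cdot> w'"
    "?W \<cdot> in2 R = sha C (in1 P) \<cdot> sha C f \<boxplus> mneg C (sha C (in2 P) \<cdot> sha C u)"
    by (simp_all add: mat2_facts[OF R sP] Hom_iff t p r)
  have U_eq: "n \<cdot> s = ?U"
    by (rule biprod_eqI_dom[OF P])
      (simp_all add: U s n t p q x cmp_reassoc[OF n(4)] cmp_reassoc[OF n(5)])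
  have y1: "y \<cdot> in1 Q = i \<cdot> v'"
    using cmp_reassoc[OF oct(1)[symmetric], of "in1 X"] by (simp add: n sn ze x t s1_def)
  have V_eq: "\<kappa> \<cdot> y = ?V"
  proof (rule biprod_eqI_dom[OF Q])
    show "(\<kappa> \<cdot> y) \<cdot> in1 Q = ?V \<cdot> in1 Q"
      by (simp add: V \<kappa>h ze q y1 t cmp_reassoc[OF \<kappa>h(4)])
    show "(\<kappa> \<cdot> y) \<cdot> in2 Q = ?V \<cdot> in2 Q"
    proof (rule biprod_eqI_cod[OF R])
      have "e \<cdot> (y \<cdot> in2 Q) = mneg C w"
        using cmp_reassoc[OF oct(3), of "in2 Q"] by (simp add: n1_def ze q t)
      then show "pr2 R \<cdot> ((\<kappa> \<cdot> y) \<cdot> in2 Q) = pr2 R \<cdot> (?V \<cdot> in2 Q)"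
        by (simp add: V(5) \<kappa>h(1-3) cmp_reassoc[OF \<kappa>h(7)] ze q r t hh)
      show "pr1 R \<cdot> ((\<kappa> \<cdot> y) \<cdot> in2 Q) = pr1 R \<cdot> (?V \<cdot> in2 Q)"
        by (simp add: V(5) \<kappa>h(1-3) cmp_reassoc[OF \<kappa>h(6)] h_def[symmetric] ze q r t hh)
    qed (simp_all add: V(1-3) \<kappa>h(1-3) ze q)
  qed (simp_all add: V \<kappa>h ze q)
  have W_eq: "?W \<cdot> \<kappa> = k"
  proof (rule biprod_eqI_dom[OF B, simplified])
    show "(?W \<cdot> \<kappa>) \<cdot> i = k \<cdot> i"
      by (simp add: W(1-4) \<kappa>h(1-4) ze oct(2) s2_def)
    show "(?W \<cdot> \<kappa>) \<cdot> j = k \<cdot> j"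
      by (simp add: W(1-3) W(5) \<kappa>h(1-5) jh kj p t)
  qed (simp_all add: W(1-3) \<kappa>h(1-3) ze)
  have cone: "tri2 (sum_ob P) (sum_ob Q) (sum_ob R) ?U ?V ?W \<in> D 2"
    using transport[OF Z inverses_ident inverses_ident \<kappa>, of ?U ?V ?W]
    by (simp add: Hom_iff U V W p q r U_eq V_eq W_eq ze)
  \<comment> \<open>Consecutive maps of the cone compose to zero; two of the matrix entries of these equations say that \<open>h\<close> completes \<open>(f, g)\<close> to a map of triangles.\<close>
  have "?V \<cdot> (?U \<cdot> in2 P) = mzero C b (sum_ob R)"
    using arg_cong[OF comp_vu_zero[OF cone], of "\<lambda>m. m \<cdot> in2 P"] by (simp add: U(1-3) V(1-3) p r)
  then have "pr1 R \<cdot> (?V \<cdot> (?U \<cdot> in2 P)) = mzero C b c'"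
    by (simp add: r p)
  moreover have "pr1 R \<cdot> (?V \<cdot> (?U \<cdot> in2 P)) = v' \<cdot> g \<boxplus> mneg C (h \<cdot> v)"
    by (simp add: U(5) V(1-3) cmp_reassoc[OF V(4)] cmp_reassoc[OF V(5)] t q r hh)
  ultimately have hv: "h \<cdot> v = v' \<cdot> g"
    using eq_if_diff_zero[of "v' \<cdot> g" "h \<cdot> v"] by (simp add: t hh)
  have "?W \<cdot> (?V \<cdot> in2 Q) = mzero C c (sho C (sum_ob P))"
    using arg_cong[OF comp_wv_zero[OF cone], of "\<lambda>m. m \<cdot> in2 Q"] by (simp add: W(1-3) V(1-3) q p)
  then have "sha C (pr1 P) \<cdot> (?W \<cdot> (?V \<cdot> in2 Q)) = mzero C c (sho C a')"
    by (simp add: q p)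
  moreover have "sha C (pr1 P) \<cdot> (?W \<cdot> (?V \<cdot> in2 Q)) = w' \<cdot> h \<boxplus> mneg C (sha C f \<cdot> w)"
    by (simp add: V(5) W(1-3) cmp_reassoc[OF W(4)] cmp_reassoc[OF W(5)] t p sp q r hh)
  ultimately have wh: "w' \<cdot> h = sha C f \<cdot> w"
    using eq_if_diff_zero[of "w' \<cdot> h" "sha C f \<cdot> w"] by (simp add: t hh)
  show ?thesis
    using that[OF h hv wh] cone by (simp add: mapping_cone_def)
qed

text \<open>The shear of \<open>b' \<oplus> c\<close> with entry \<open>-\<theta> w\<close> is an isomorphism of cones. It fixes the first map
  because \<open>w v = 0\<close>, and it turns the entry \<open>h + v' \<theta> w\<close> of the second map into \<open>h\<close>.\<close>

lemma cone_perturb: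
  assumes T: "tri2 a b c u v w \<in> D 2" and T': "tri2 a' b' c' u' v' w' \<in> D 2"
    and f: "f \<in> Hom C a a'" and g: "g \<in> Hom C b b'"
    and h: "h \<in> Hom C c c'" and th: "\<theta> \<in> Hom C (sho C a) b'"
    and P: "is_biproduct C a' b P" and Q: "is_biproduct C b' c Q" and R: "is_biproduct C c' (sho C a) R"
    and cone: "mapping_cone C P Q R a b c u v w a' b' c' u' v' w' f g h \<in> D 2"
  shows "mapping_cone C P Q R a b c u v w a' b' c' u' v' w' f g (h \<boxplus> v' \<cdot> (\<theta> \<cdot> w)) \<in> D 2"
proof -
  note t = tri2_facts[OF T] tri2_facts[OF T'] f[unfolded Hom_iff] g[unfolded Hom_iff]
    h[unfolded Hom_iff] th[unfolded Hom_iff]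
  note p = biprod_facts[OF P] and q = biprod_facts[OF Q] and r = biprod_facts[OF R]
    and sP = is_biproduct_shift[OF P]
  define h' where "h' = h \<boxplus> v' \<cdot> (\<theta> \<cdot> w)"
  have h': "h' \<in> Hom C c c'"
    and inh': "in1 R \<cdot> h' = in1 R \<cdot> h \<boxplus> in1 R \<cdot> (v' \<cdot> (\<theta> \<cdot> w))"
    by (simp_all add: h'_def Hom_iff t r)
  let ?U = "mat2 C P Q u' g (mzero C a' c) (mneg C v)"
  let ?V = "\<lambda>h. mat2 C Q R v' h (mzero C b' (sho C a)) (mneg C w)"
  let ?W = "mat2 C R (shift_biprod C P) w' (sha C f) (mzero C c' (sho C b)) (mneg C (sha C u))"
  have U: "?U \<in> Arr C" "src C ?U = sum_ob P" "tgt C ?U = sum_ob Q" "pr2 Q \<cdot> ?U = mneg C (v \<cdot> pr2 P)"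
    by (simp_all add: mat2_facts[OF P Q] Hom_iff t p q)
  have V: "?V k \<in> Arr C" "src C (?V k) = sum_ob Q" "tgt C (?V k) = sum_ob R"
    "?V k \<cdot> in1 Q = in1 R \<cdot> v'" "?V k \<cdot> in2 Q = in1 R \<cdot> k \<boxplus> mneg C (in2 R \<cdot> w)"
    if "k \<in> Hom C c c'" for k
    using that by (simp_all add: mat2_facts[OF Q R] Hom_iff t q r)
  note Vh = V[OF h] and Vh' = V[OF h']
  have W: "?W \<in> Arr C" "src C ?W = sum_ob R" "tgt C ?W = sho C (sum_ob P)"
    by (simp_all add: mat2_facts[OF R sP] Hom_iff t p r)
  define d where "d = in1 Q \<cdot> (\<theta> \<cdot> (w \<cdot> pr2 Q))"
  let ?I = "ident C (sum_ob Q)"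
  have d: "d \<in> Arr C" "src C d = sum_ob Q" "tgt C d = sum_ob Q"
    "d \<cdot> d = mzero C (sum_ob Q) (sum_ob Q)" "d \<cdot> in1 Q = mzero C b' (sum_ob Q)" "d \<cdot> in2 Q = in1 Q \<cdot> (\<theta> \<cdot> w)"
    by (simp_all add: d_def t q)
  have inv: "inverses (sum_ob Q) (sum_ob Q) (?I \<boxplus> mneg C d) (?I \<boxplus> d)"
    using d(4) by (simp add: inverses_def Hom_iff d(1-3) q madd_ac)
  have "d \<cdot> ?U = mzero C (sum_ob P) (sum_ob Q)"
    by (simp add: d_def U t p q cmp_reassoc[OF comp_wv_zero[OF T]])
  then have dU: "(?I \<boxplus> mneg C d) \<cdot> ?U = ?U"
    using U(1-3) d(1-3) p q by simp
  have dV: "?V h' \<cdot> (?I \<boxplus> mneg C d) = ?V h"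
  proof (rule biprod_eqI_dom[OF Q])
    show "(?V h' \<cdot> (?I \<boxplus> mneg C d)) \<cdot> in1 Q = ?V h \<cdot> in1 Q"
      by (simp add: Vh(1-4) Vh'(1-4) d(1-3,5) t q r)
    show "(?V h' \<cdot> (?I \<boxplus> mneg C d)) \<cdot> in2 Q = ?V h \<cdot> in2 Q"
      by (simp add: Vh(1-3,5) Vh'(1-3,5) d(1-3,6) cmp_reassoc[OF Vh'(4)] inh' t q r madd_ac)
  qed (simp_all add: Vh(1-3) Vh'(1-3) d(1-3) q)
  have "tri2 (sum_ob P) (sum_ob Q) (sum_ob R) ?U (?V h) ?W \<in> D 2"
    using cone by (simp add: mapping_cone_def)
  from transport[OF this inverses_ident inv inverses_ident, of ?U "?V h'" ?W]
  have "tri2 (sum_ob P) (sum_ob Q) (sum_ob R) ?U (?V h') ?W \<in> D 2"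
    by (simp add: Hom_iff U(1-3) Vh(1-3) Vh'(1-3) W p q r dU dV)
  then show ?thesis by (simp add: mapping_cone_def h'_def)
qed

lemma mapping_cone_distinguished:
  assumes T: "tri2 a b c u v w \<in> D 2" and T': "tri2 a' b' c' u' v' w' \<in> D 2"
    and map: "tri2_map f g h \<in> tri_maps C 2 (tri2 a b c u v w) (tri2 a' b' c' u' v' w')"
    and P: "is_biproduct C a' b P" and Q: "is_biproduct C b' c Q" and R: "is_biproduct C c' (sho C a) R"
  shows "mapping_cone C P Q R a b c u v w a' b' c' u' v' w' f g h \<in> D 2"
proof -
  note t = tri2_facts[OF T] tri2_facts[OF T']
  have f: "f \<in> Hom C a a'" and g: "g \<in> Hom C b b'" and h: "h \<in> Hom C c c'"
    and gu: "g \<cdot> u = u' \<cdot> f" and hv: "h \<cdot> v = v' \<cdot> g" and wh: "sha C f \<cdot> w = w' \<cdot> h"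
    using map by (simp_all add: tri2_map_in_tri_maps)
  obtain h0 where h0: "h0 \<in> Hom C c c'" "h0 \<cdot> v = v' \<cdot> g" "w' \<cdot> h0 = sha C f \<cdot> w"
    and cone: "mapping_cone C P Q R a b c u v w a' b' c' u' v' w' f g h0 \<in> D 2"
    using cone_exists[OF T T' f g gu P Q R] .
  note m = f[unfolded Hom_iff] g[unfolded Hom_iff] h[unfolded Hom_iff] h0(1)[unfolded Hom_iff]
  define e where "e = h \<boxplus> mneg C h0"
  have e: "e \<in> Hom C c c'" "e \<cdot> v = mzero C b c'" "w' \<cdot> e = mzero C c (sho C a')"
    by (simp_all add: e_def Hom_iff m t hv h0(2,3) flip: wh)
  obtain \<theta> where th: "\<theta> \<in> Hom C (sho C a) b'" "e = v' \<cdot> (\<theta> \<cdot> w)"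
    using lightning_strike[OF T T' e] .
  have "h = h0 \<boxplus> v' \<cdot> (\<theta> \<cdot> w)"
    by (simp add: e_def m madd_ac flip: th(2))
  then show ?thesis
    using cone_perturb[OF T T' f g h0(1) th(1) P Q R cone] by simp
qed

end

theorem corollary4p12:
  fixes C :: "('o, 'm) shift_cat"
    and D :: "nat \<Rightarrow> ('o, 'm) tri set"
    and M :: "nat \<Rightarrow> ('o, 'm) tri \<Rightarrow> ('o, 'm) tri \<Rightarrow> (nat \<Rightarrow> nat \<Rightarrow> 'm) set"
    and a b c a' b' c' :: 'o and u v w u' v' w' f g h :: 'm
    and P Q R :: "('o, 'm) biprod"
  assumes "fully_triangulated C D M"
    and "tri2_map f g h \<in> M 2 (tri2 a b c u v w) (tri2 a' b' c' u' v' w')"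
    and "is_biproduct C a' b P"
    and "is_biproduct C b' c Q"
    and "is_biproduct C c' (sho C a) R"
  shows "mapping_cone C P Q R a b c u v w a' b' c' u' v' w' f g h \<in> D 2"
proof -
  interpret fully_triangulated C D M by fact
  have "tri2 a b c u v w \<in> D 2" "tri2 a' b' c' u' v' w' \<in> D 2"
    "tri2_map f g h \<in> tri_maps C 2 (tri2 a b c u v w) (tri2 a' b' c' u' v' w')"
    using dist_map[OF order_refl assms(2)] by simp_all
  then show ?thesis
    using mapping_cone_distinguished assms(3-5) by blast
qed

end
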